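(* Let $G$ be an acyclic network with a source $S$, destinations $T_1,\dots,T_N$ (distinct from $S$) and connections $\mathcal C=\{(S,T_1,\mathcal X(S)),(S,T_2,\mathcal X(S)),\dots,(S,T_N,\mathcal X(S))\}$. Then $(G,\mathcal C)$ is solvable if and only if $mincut(S,T_i)\ge|\mathcal X(S)|$ for all $i\in\{1,\dots,N\}$.
   Context: Network. $G=(\mathcal V,\mathcal E)$ consists of a finite set $\mathcal V$ of nodes; each node $V$ has a finite set $I(V)$ of input ports and a finite set $O(V)$ of output ports (all pairwise disjoint). Each edge in $\mathcal E$ is an ordered pair $(e_1,e_2)$ with $e_1\in O(V_1)$ and $e_2\in I(V_2)$ for some $V_1,V_2\in\mathcal V$. $G$ is acyclic if the directed graph on $\mathcal V$ with an arc $V_1\to V_2$ whenever some edge goes from $O(V_1)$ to $I(V_2)$ has no directed cycle. Linear transmission over a finite field. The source $S$ has independent symbols $\mathcal X(S)=[X(S,1),\dots,X(S,\mu(S))]$, $\mu(S)=|\mathcal X(S)|\le|O(S)|$. $Y(e)$ denotes the symbol at port $e$. For $e\in O(V)$: $Y(e)=\sum_{e'\in I(V)}\beta_{(e',e)}Y(e')$, plus $\sum_i\alpha_{(i,e)}X(S,i)$ if $V=S$. For an input port $e'$: $Y(e')=\sum_{(e,e')\in\mathcal E}Y(e)$. A destination $T$ forms $Z(T,k)=\sum_{e'\in I(T)}\epsilon_{(e',(T,k))}Y(e')$, $1\le k\le\nu(T)$. The coefficients $\alpha,\beta,\epsilon$ are free. A connection $(S,T,\mathcal X(S,T))$ is established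 if the processes of $\mathcal X(S,T)$ are among the components of $\mathcal Z(T)=[Z(T,1),\dots,Z(T,\nu(T))]$, for all values of the source symbols. Solvability and field size. A base finite field $\mathbb F_q$ is given; the field size is not restricted, so $(G,\mathcal C)$ is called solvable if for some finite extension field of $\mathbb F_q$ (with symbols, coefficients and additions in it) the coefficients can be chosen so that all connections in $\mathcal C$ are established simultaneously. Min-cut. $mincut(S,T)=\min_\Omega\operatorname{rank}(G_\Omega)$ over all $\Omega\subseteq\mathcal V$ with $S\in\Omega$, $T\notin\Omega$, where $G_\Omega$ is the $0$-$1$ matrix over $\mathbb F_q$ with rows the output ports of nodes in $\Omega$, columns the input ports of nodes in $\Omega^c$, and entry $1$ exactly when there is an edge from the row port to the column port. *)

theory Defs
  imports
    "HOL-Algebra.Algebraic_Closure_Type"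
    "HOL-Library.Countable_Set"
    "Jordan_Normal_Form.DL_Rank"
begin

record ('v, 'p) network =
  nodes :: "'v set"
  in_ports :: "'v \<Rightarrow> 'p set"
  out_ports :: "'v \<Rightarrow> 'p set"
  edges :: "('p \<times> 'p) set"

definition wf_network :: "('v, 'p) network \<Rightarrow> bool" where
  "wf_network G \<longleftrightarrow>
     finite (nodes G) \<and>
     (\<forall>V\<in>nodes G. finite (in_ports G V) \<and> finite (out_ports G V)) \<and>
     (\<forall>V\<in>nodes G. \<forall>W\<in>nodes G. in_ports G V \<inter> out_ports G W = {}) \<and>
     (\<forall>V\<in>nodes G. \<forall>W\<in>nodes G. V \<noteq> W \<longrightarrow>
        in_ports G V \<inter> in_ports G W = {} \<and> out_ports G V \<inter> out_ports G W = {}) \<and>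
     (\<forall>(e1, e2)\<in>edges G. \<exists>V1\<in>nodes G. \<exists>V2\<in>nodes G. e1 \<in> out_ports G V1 \<and> e2 \<in> in_ports G V2)"

definition arcs :: "('v, 'p) network \<Rightarrow> ('v \<times> 'v) set" where
  "arcs G = {(V1, V2). V1 \<in> nodes G \<and> V2 \<in> nodes G \<and>
     (\<exists>e1\<in>out_ports G V1. \<exists>e2\<in>in_ports G V2. (e1, e2) \<in> edges G)}"

definition acyclic_network :: "('v, 'p) network \<Rightarrow> bool" where
  "acyclic_network G \<longleftrightarrow> acyclic (arcs G)"

text \<open>
  The coefficients of a linear transmission scheme: \<open>src c i e\<close> is $\alpha_{(i,e)}$,
  \<open>fwd c e' e\<close> is $\beta_{(e',e)}$, \<open>dst c e' (T, k)\<close> is $\epsilon_{(e',(T,k))}$.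
  The number $\nu(T)$ of symbols formed at a destination belongs to the scheme, since
  no bound on it is prescribed by the network.
\<close>

record ('v, 'p, 'a) scheme =
  src :: "nat \<Rightarrow> 'p \<Rightarrow> 'a"
  fwd :: "'p \<Rightarrow> 'p \<Rightarrow> 'a"
  dst :: "'p \<Rightarrow> 'v \<times> nat \<Rightarrow> 'a"
  nu :: "'v \<Rightarrow> nat"

definition scheme_over :: "'a set \<Rightarrow> ('v, 'p, 'a) scheme \<Rightarrow> bool" where
  "scheme_over K c \<longleftrightarrow>
     (\<forall>i e. src c i e \<in> K) \<and> (\<forall>e' e. fwd c e' e \<in> K) \<and> (\<forall>e' Tk. dst c e' Tk \<in> K)"

text \<open>
  \<open>port_symbols K G S m c x Y\<close>: the assignment \<open>Y\<close> of symbols of the field \<open>K\<close> to the ports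
  satisfies all transmission equations when the source \<open>S\<close> emits the symbols \<open>x 1, \<dots>, x m\<close>.
\<close>

definition port_symbols ::
  "'a::field set \<Rightarrow> ('v, 'p) network \<Rightarrow> 'v \<Rightarrow> nat \<Rightarrow> ('v, 'p, 'a) scheme \<Rightarrow>
   (nat \<Rightarrow> 'a) \<Rightarrow> ('p \<Rightarrow> 'a) \<Rightarrow> bool" where
  "port_symbols K G S m c x Y \<longleftrightarrow>
     (\<forall>V\<in>nodes G. \<forall>e\<in>in_ports G V \<union> out_ports G V. Y e \<in> K) \<and>
     (\<forall>V\<in>nodes G. \<forall>e\<in>out_ports G V.
        Y e = (\<Sum>e'\<in>in_ports G V. fwd c e' e * Y e')
            + (if V = S then \<Sum>i=1..m. src c i e * x i else 0)) \<and>
     (\<forall>V\<in>nodes G. \<forall>e'\<in>in_ports G V. Y e' = (\<Sum>e | (e, e') \<in> edges G. Y e))"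

lemma subfield_type_closed:
  fixes K :: "'a::field set"
  assumes "subfield K (ring_of_type_algebra :: 'a ring)"
  shows "0 \<in> K" and "a \<in> K \<Longrightarrow> b \<in> K \<Longrightarrow> a + b \<in> K"
    and "a \<in> K \<Longrightarrow> b \<in> K \<Longrightarrow> a * b \<in> K"
    and "(\<And>i. i \<in> A \<Longrightarrow> f i \<in> K) \<Longrightarrow> sum f A \<in> K"
proof -
  note sr = subringE[OF subfieldE(1)[OF assms]]
  show 0: "0 \<in> K" using sr(2) by (simp add: ring_of_type_algebra_def)
  show plus: "a + b \<in> K" if "a \<in> K" "b \<in> K" for a b
    using sr(7)[OF that] by (simp add: ring_of_type_algebra_def)
  show "a * b \<in> K" if "a \<in> K" "b \<in> K" for a b
    using sr(6)[OF that] by (simp add: ring_of_type_algebra_def)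
  show "sum f A \<in> K" if "\<And>i. i \<in> A \<Longrightarrow> f i \<in> K"
    using that by (induction A rule: infinite_finite_induct) (auto simp: 0 plus)
qed

lemma finite_arcs: "wf_network G \<Longrightarrow> finite (arcs G)"
  by (rule finite_subset[of _ "nodes G \<times> nodes G"]) (auto simp: arcs_def wf_network_def)

lemma port_symbols_exist:
  assumes G: "wf_network G" "acyclic_network G"
    and K: "subfield K (ring_of_type_algebra :: 'a::field ring)"
    and c: "scheme_over K c" and x: "\<forall>j\<in>{1..m}. x j \<in> K"
  shows "\<exists>Y. port_symbols K G S m c x Y"
proof -
  define eqs where "eqs D Y \<longleftrightarrow> (\<forall>e. Y e \<in> K) \<and> (\<forall>V\<in>D. \<forall>e\<in>out_ports G V.
        Y e = (\<Sum>e'\<in>in_ports G V. fwd c e' e * Y e')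
            + (if V = S then \<Sum>i=1..m. src c i e * x i else 0)) \<and>
     (\<forall>V\<in>D. \<forall>e'\<in>in_ports G V. Y e' = (\<Sum>e | (e, e') \<in> edges G. Y e))" for D Y
  note closed = subfield_type_closed[OF K]
  have "\<exists>Y. eqs D Y" if "D \<subseteq> nodes G" "\<forall>(V, W)\<in>arcs G. W \<in> D \<longrightarrow> V \<in> D" for D
    using that
  proof (induction "card D" arbitrary: D)
    case 0
    have "finite D" using 0 G(1) finite_subset unfolding wf_network_def by blast
    with 0 have "D = {}" by simp
    then have "eqs D (\<lambda>_. 0)" by (simp add: eqs_def closed)
    then show ?case by blast
  next
    case (Suc n)
    have fin: "finite D" using Suc.prems G(1) finite_subset unfolding wf_network_def by blast
    have wf: "wf ((arcs G)\<inverse>)"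
      using G finite_acyclic_wf_converse finite_arcs unfolding acyclic_network_def by blast
    obtain d where "d \<in> D" using Suc.hyps(2) by fastforce
    then obtain v where v: "v \<in> D" "\<And>w. (w, v) \<in> (arcs G)\<inverse> \<Longrightarrow> w \<notin> D"
      using wfE_min[OF wf] by blast
    have "n = card (D - {v})" using Suc.hyps(2) v(1) fin by simp
    then have "\<exists>Y. eqs (D - {v}) Y"
      using Suc.prems v(2) by (intro Suc.hyps(1)) auto
    then obtain Y where Y: "eqs (D - {v}) Y" ..
    define Y1 where "Y1 e' = (if e' \<in> in_ports G v then \<Sum>e | (e, e') \<in> edges G. Y e else Y e')" for e'
    define Y2 where "Y2 e = (if e \<in> out_ports G v then (\<Sum>e'\<in>in_ports G v. fwd c e' e * Y1 e')
            + (if v = S then \<Sum>i=1..m. src c i e * x i else 0) else Y1 e)" for e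
    have YK: "Y e \<in> K" for e using Y by (simp add: eqs_def)
    then have Y1K: "Y1 e \<in> K" for e by (simp add: Y1_def closed)
    have cK: "src c i e \<in> K" "fwd c e' e \<in> K" for i e e' using c by (auto simp: scheme_over_def)
    have Y2K: "Y2 e \<in> K" for e
      unfolding Y2_def using x by (auto intro!: closed Y1K cK)
    have vn: "v \<in> nodes G" using v(1) Suc.prems by blast
    have inD: "e \<notin> in_ports G v" "e \<notin> out_ports G v"
      if "V \<in> D - {v}" "e \<in> in_ports G V \<union> out_ports G V" for V e
      using that vn Suc.prems(1) G(1) unfolding wf_network_def by blast+
    have same: "Y2 e = Y e" if "V \<in> D - {v}" "e \<in> in_ports G V \<union> out_ports G V" for V e
      using inD[OF that] by (simp add: Y1_def Y2_def)
    have inv: "Y2 e = Y1 e" if "e \<in> in_ports G v" for e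
      using that vn G(1) unfolding wf_network_def Y2_def by auto
    have pred: "Y2 e = Y e" if "(e, e') \<in> edges G" "e' \<in> in_ports G V" "V \<in> D" for e e' V
    proof -
      obtain V1 V2 where W: "V1 \<in> nodes G" "V2 \<in> nodes G" "e \<in> out_ports G V1" "e' \<in> in_ports G V2"
        using G(1) \<open>(e, e') \<in> edges G\<close> unfolding wf_network_def by fast
      have "V \<in> nodes G" using Suc.prems(1) \<open>V \<in> D\<close> by blast
      then have arc: "(V1, V) \<in> arcs G" using W that unfolding arcs_def by blast
      then have "V1 \<in> D" using Suc.prems(2) \<open>V \<in> D\<close> by blast
      moreover have "V1 \<noteq> v" using v(2)[of V] arc \<open>V \<in> D\<close> by auto
      ultimately show ?thesis using same[of V1 e] W(3) by blast
    qed
    have "eqs D Y2"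
      unfolding eqs_def
    proof (intro conjI ballI allI)
      fix e show "Y2 e \<in> K" by (rule Y2K)
    next
      fix V e assume V: "V \<in> D" "e \<in> out_ports G V"
      show "Y2 e = (\<Sum>e'\<in>in_ports G V. fwd c e' e * Y2 e')
            + (if V = S then \<Sum>i=1..m. src c i e * x i else 0)"
      proof (cases "V = v")
        case True
        have "(\<Sum>e'\<in>in_ports G V. fwd c e' e * Y2 e') = (\<Sum>e'\<in>in_ports G v. fwd c e' e * Y1 e')"
          using True inv by (intro sum.cong) auto
        then show ?thesis using True V(2) by (simp add: Y2_def)
      next
        case False
        have "(\<Sum>e'\<in>in_ports G V. fwd c e' e * Y2 e') = (\<Sum>e'\<in>in_ports G V. fwd c e' e * Y e')"
          using False V same by (intro sum.cong) auto
        then show ?thesis using False V Y same[of V e] by (simp add: eqs_def)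
      qed
    next
      fix V e' assume V: "V \<in> D" "e' \<in> in_ports G V"
      have *: "(\<Sum>e | (e, e') \<in> edges G. Y2 e) = (\<Sum>e | (e, e') \<in> edges G. Y e)"
        using V pred by (intro sum.cong) auto
      show "Y2 e' = (\<Sum>e | (e, e') \<in> edges G. Y2 e)"
      proof (cases "V = v")
        case True
        then show ?thesis using * V inv by (simp add: Y1_def)
      next
        case False
        then show ?thesis using * V Y same[of V e'] by (simp add: eqs_def)
      qed
    qed
    then show ?case by blast
  qed
  from this[of "nodes G"] obtain Y where "eqs (nodes G) Y" by (auto simp: arcs_def)
  then have "port_symbols K G S m c x Y" by (simp add: eqs_def port_symbols_def)
  then show ?thesis by blast
qed

lemma port_symbols_unique:
  assumes G: "wf_network G" "acyclic_network G"
    and Y: "port_symbols K G S m c x Y" and Y': "port_symbols K G S m c x Y'"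
    and "V \<in> nodes G" "e \<in> in_ports G V \<union> out_ports G V"
  shows "Y e = Y' e"
proof -
  have wf: "wf (arcs G)"
    using G finite_acyclic_wf finite_arcs unfolding acyclic_network_def by blast
  have "\<forall>e\<in>in_ports G V \<union> out_ports G V. Y e = Y' e" if "V \<in> nodes G" for V
    using wf that
  proof (induction V rule: wf_induct_rule)
    case (less V)
    have inp: "Y e' = Y' e'" if e': "e' \<in> in_ports G V" for e'
    proof -
      have "Y e = Y' e" if e: "(e, e') \<in> edges G" for e
      proof -
        obtain V1 where "V1 \<in> nodes G" "e \<in> out_ports G V1"
          using G(1) e unfolding wf_network_def by fast
        moreover from this have "(V1, V) \<in> arcs G"
          using e e' less.prems unfolding arcs_def by blast
        ultimately show ?thesis using less.IH by blast
      qed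
      then have "(\<Sum>e | (e, e') \<in> edges G. Y e) = (\<Sum>e | (e, e') \<in> edges G. Y' e)"
        by (intro sum.cong) auto
      then show ?thesis using Y Y' e' less.prems by (simp add: port_symbols_def)
    qed
    moreover have "Y e = Y' e" if e: "e \<in> out_ports G V" for e
    proof -
      have "(\<Sum>e'\<in>in_ports G V. fwd c e' e * Y e') = (\<Sum>e'\<in>in_ports G V. fwd c e' e * Y' e')"
        using inp by (intro sum.cong) auto
      then show ?thesis using Y Y' e less.prems by (simp add: port_symbols_def)
    qed
    ultimately show ?case by blast
  qed
  then show ?thesis using assms(5,6) by blast
qed

definition dest_symbol ::
  "('v, 'p) network \<Rightarrow> ('v, 'p, 'a::field) scheme \<Rightarrow> ('p \<Rightarrow> 'a) \<Rightarrow> 'v \<Rightarrow> nat \<Rightarrow> 'a" where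
  "dest_symbol G c Y T k = (\<Sum>e'\<in>in_ports G T. dst c e' (T, k) * Y e')"

text \<open>
  A connection is a triple of a source, a destination and the set of the indices of the
  source processes requested there. Port symbols are quantified universally; in an acyclic
  network they exist and are unique, by \<open>port_symbols_exist\<close> and \<open>port_symbols_unique\<close>.
\<close>

type_synonym 'v connection = "'v \<times> 'v \<times> nat set"

fun established ::
  "'a::field set \<Rightarrow> ('v, 'p) network \<Rightarrow> 'v \<Rightarrow> nat \<Rightarrow> ('v, 'p, 'a) scheme \<Rightarrow> 'v connection \<Rightarrow> bool" where
  "established K G S m c (S', T, R) \<longleftrightarrow>
     S' = S \<and> R \<subseteq> {1..m} \<and>
     (\<forall>i\<in>R. \<exists>k\<in>{1..nu c T}. \<forall>x Y.
        (\<forall>j\<in>{1..m}. x j \<in> K) \<longrightarrow> port_symbols K G S m c x Y \<longrightarrow>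
        dest_symbol G c Y T k = x i)"

text \<open>
  The base field is the finite field type \<open>'f\<close>. Finite extension fields of it are taken inside
  its algebraic closure, into which each of them embeds.
\<close>

definition finite_extension :: "'f::field alg_closure set \<Rightarrow> bool" where
  "finite_extension K \<longleftrightarrow>
     subfield K (ring_of_type_algebra :: 'f alg_closure ring) \<and> range to_ac \<subseteq> K \<and> finite K"

definition solvable ::
  "'f::{field, finite} itself \<Rightarrow> ('v, 'p) network \<Rightarrow> 'v \<Rightarrow> nat \<Rightarrow> 'v connection set \<Rightarrow> bool" where
  "solvable _ G S m C \<longleftrightarrow>
     (\<exists>(K :: 'f alg_closure set) (c :: ('v, 'p, 'f alg_closure) scheme).
        finite_extension K \<and> scheme_over K c \<and> (\<forall>con\<in>C. established K G S m c con))"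

definition row_ports :: "('v, 'p) network \<Rightarrow> 'v set \<Rightarrow> 'p set" where
  "row_ports G \<Omega> = (\<Union>V\<in>\<Omega>. out_ports G V)"

definition col_ports :: "('v, 'p) network \<Rightarrow> 'v set \<Rightarrow> 'p set" where
  "col_ports G \<Omega> = (\<Union>V\<in>nodes G - \<Omega>. in_ports G V)"

text \<open>
  The rows and columns of the matrix $G_\Omega$ are ordered by the enumerations
  \<^term>\<open>from_nat_into\<close> of the two port sets; its rank does not depend on this choice.
\<close>

definition cut_matrix :: "('v, 'p) network \<Rightarrow> 'v set \<Rightarrow> 'f::field mat" where
  "cut_matrix G \<Omega> = mat (card (row_ports G \<Omega>)) (card (col_ports G \<Omega>))
     (\<lambda>(i, j). if (from_nat_into (row_ports G \<Omega>) i, from_nat_into (col_ports G \<Omega>) j) \<in> edges G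
               then 1 else 0)"

definition mincut :: "'f::{field, finite} itself \<Rightarrow> ('v, 'p) network \<Rightarrow> 'v \<Rightarrow> 'v \<Rightarrow> nat" where
  "mincut _ G S T =
     Min {vec_space.rank (card (row_ports G \<Omega>)) (cut_matrix G \<Omega> :: 'f mat) | \<Omega>.
          \<Omega> \<subseteq> nodes G \<and> S \<in> \<Omega> \<and> T \<notin> \<Omega>}"

end

theory Submission
  imports Defs
begin

text \<open>
  Necessity: for a cut \<open>\<Omega>\<close>, write $G_\Omega = B Q$ with $r = \mathrm{rank}(G_\Omega)$ columns in \<open>B\<close>. The
  symbols beyond the cut depend only on the \<open>r\<close> symbols that \<open>B\<close> produces from those sent in
  \<open>\<Omega>\<close>, so decoding yields an injection $K^m \to K^r$, whence $m \le r$ for finite \<open>K\<close>.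

  Sufficiency: work over the algebraic closure and fix the coding coefficients one output port at a
  time, in topological order. Once the ports in \<open>P\<close> carry fixed linear functions of the source
  symbols, consider the cuts of the remaining network that have the source symbols and a set \<open>Q\<close> of
  uncoded ports on the source side; the invariant is that all of them have rank at least \<open>m\<close>.
  Coding the port \<open>e\<close> changes the matrix \<open>A\<close> of a cut into \<open>A + b f\<close>, where \<open>b\<close> is the
  column of \<open>e\<close> and \<open>f\<close> a combination of the inputs of its node. Moving \<open>e\<close> to the source side
  appends the column \<open>b\<close> to \<open>A\<close>, keeping it on the sink side appends the input rows, and
  both matrices have rank at least \<open>m\<close> by the invariant. Hence \<open>A + b f\<close> has rank at least \<open>m\<close> for generic
  \<open>f\<close>, and one \<open>f\<close> serves the finitely many cuts of all destinations, because the field is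
  infinite. When all ports are coded, every destination can invert its transfer matrix. The finitely many
  coefficients used lie in a finite subfield, the fixed field of a power of Frobenius.
\<close>

subsection \<open>Finite subfields of the algebraic closure\<close>

text \<open>If the field were finite, the product of all \<open>[:- a, 1:]\<close> plus 1 would have
  positive degree and take the value 1 everywhere, so it would have no root.\<close>

lemma infinite_UNIV_alg_closed:
  "infinite (UNIV :: 'a::alg_closed_field set)"
proof
  assume fin: "finite (UNIV :: 'a set)"
  define p :: "'a poly" where "p = (\<Prod>a\<in>UNIV. [:- a, 1:]) + 1"
  have "degree (\<Prod>a\<in>(UNIV :: 'a set). [:- a, 1:]) = card (UNIV :: 'a set)"
    by (subst degree_prod_sum_eq) auto
  moreover have "card (UNIV :: 'a set) > 0" using fin by (simp add: card_gt_0_iff)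
  ultimately have "degree p > 0" unfolding p_def by (subst degree_add_eq_left) auto
  then obtain x where "poly p x = 0" using alg_closed_imp_poly_has_root by blast
  moreover have "poly p x = 1" using fin by (simp add: p_def poly_prod prod_zero)
  ultimately show False by simp
qed

lemma frobenius_inj:
  fixes x y :: "'a::field"
  assumes "prime CHAR('a)" and "x ^ (CHAR('a) ^ n) = y ^ (CHAR('a) ^ n)"
  shows "x = y"
proof -
  have "(y + (x - y)) ^ (CHAR('a) ^ n) = y ^ (CHAR('a) ^ n) + (x - y) ^ (CHAR('a) ^ n)"
    by (rule freshmans_dream') (use assms in auto)
  then have "(x - y) ^ (CHAR('a) ^ n) = 0" using assms(2) by simp
  then show ?thesis by simp
qed

text \<open>By the pigeonhole principle two iterates of \<open>x\<close> in the finite set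
  \<open>A\<close> coincide, and injectivity of Frobenius cancels the smaller exponent.\<close>

lemma frobenius_periodic:
  fixes x :: "'a::field"
  assumes p: "prime CHAR('a)" and fin: "finite A" and A: "\<And>i. x ^ (CHAR('a) ^ (N * i)) \<in> A"
    and N: "N > 0"
  shows "\<exists>n>0. x ^ (CHAR('a) ^ n) = x"
proof -
  have "\<not> inj (\<lambda>i. x ^ (CHAR('a) ^ (N * i)))"
    using fin A by (metis finite_subset image_subset_iff infinite_UNIV_nat finite_imageD)
  then obtain i j where ij: "i < j" "x ^ (CHAR('a) ^ (N * i)) = x ^ (CHAR('a) ^ (N * j))"
    unfolding inj_def by (metis nat_neq_iff)
  have "N * j = N * (j - i) + N * i"
    using ij(1) by (simp flip: distrib_left)
  then have "x ^ (CHAR('a) ^ (N * i)) = (x ^ (CHAR('a) ^ (N * (j - i)))) ^ (CHAR('a) ^ (N * i))"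
    using ij(2) by (simp add: power_add power_mult)
  from frobenius_inj[OF p this] show ?thesis using ij(1) N by (metis nat_0_less_mult_iff zero_less_diff)
qed

lemma frobenius_iterate:
  fixes x :: "'a::comm_semiring_1"
  assumes "x ^ (q ^ n) = x"
  shows "x ^ (q ^ (n * k)) = x"
  by (induction k) (use assms in \<open>simp_all add: power_add power_mult\<close>)

text \<open>Products of periods are again periods, so finitely many elements share one.\<close>

lemma frobenius_common_period:
  fixes A :: "'a::comm_semiring_1 set"
  assumes "finite A" "\<And>x. x \<in> A \<Longrightarrow> \<exists>n>0. x ^ (q ^ n) = x"
  shows "\<exists>n>0. \<forall>x\<in>A. x ^ (q ^ n) = x"
  using assms
proof (induction A)
  case empty
  show ?case by auto
next
  case (insert a A)
  then obtain n k where "n > 0" "\<forall>x\<in>A. x ^ (q ^ n) = x" "k > 0" "a ^ (q ^ k) = a"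
    by (metis insertI1 insertI2)
  moreover have "a ^ (q ^ (n * k)) = a"
    using frobenius_iterate[of a q k n] \<open>a ^ (q ^ k) = a\<close> by (simp add: mult.commute)
  ultimately have "n * k > 0 \<and> (\<forall>x\<in>insert a A. x ^ (q ^ (n * k)) = x)"
    using frobenius_iterate[of _ q n k] by auto
  then show ?case by blast
qed

text \<open>Every element of the closure is fixed by some power of Frobenius. The set fixed by a
  common power for \<open>A\<close> and the base field is a subfield by the freshman's dream, and
  finite as the set of roots of a nonzero polynomial.\<close>

lemma finite_extension_containing:
  fixes A :: "'f::{field, finite} alg_closure set"
  assumes fin: "finite A"
  shows "\<exists>K :: 'f alg_closure set. finite_extension K \<and> A \<subseteq> K"
proof -
  let ?p = "CHAR('f)"
  have "?p > 0" by (rule finite_imp_CHAR_pos) simp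
  then have p: "prime ?p" using prime_CHAR_semidom by blast
  have "\<exists>n>0. y ^ (?p ^ n) = y" for y :: 'f
    using frobenius_periodic[where A = UNIV and N = 1 and x = y] p by auto
  then obtain N where N: "N > 0" "\<And>y :: 'f. y ^ (?p ^ N) = y"
    using frobenius_common_period[of "UNIV :: 'f set" ?p] by auto
  have alg: "\<exists>n>0. x ^ (?p ^ n) = x" for x :: "'f alg_closure"
  proof -
    obtain P :: "'f poly" where P: "P \<noteq> 0" "poly (map_poly to_ac P) x = 0"
      by (rule alg_closure_algebraic)
    define Q where "Q = map_poly to_ac P"
    \<comment> \<open>The coefficients of \<open>Q\<close> come from the base field and are fixed by
      the \<open>N\<close>-fold Frobenius, so its iterates send \<open>x\<close> to roots of
      \<open>Q\<close>, which are finite in number.\<close>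
    have fixQ: "coeff Q i ^ (?p ^ (N * k)) = coeff Q i" for i k
      by (intro frobenius_iterate) (simp add: Q_def coeff_map_poly N(2) flip: to_ac_power)
    have "Q \<noteq> 0" using P(1) by (simp add: Q_def poly_eq_iff coeff_map_poly)
    moreover have "poly Q (x ^ (?p ^ (N * k))) = 0" for k
    proof -
      let ?r = "?p ^ (N * k)"
      have "poly Q (x ^ ?r) = (\<Sum>i\<le>degree Q. (coeff Q i * x ^ i) ^ ?r)"
        unfolding poly_altdef
        by (intro sum.cong) (simp_all add: fixQ power_mult_distrib mult.commute flip: power_mult)
      also have "\<dots> = poly Q x ^ ?r"
        unfolding poly_altdef by (rule freshmans_dream_sum'[symmetric]) (use p in auto)
      finally show ?thesis using P(2) \<open>?p > 0\<close> by (simp add: Q_def)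
    qed
    ultimately show ?thesis
      using frobenius_periodic[where A = "{y. poly Q y = 0}" and N = N and x = x] p N(1)
      by (auto intro: poly_roots_finite)
  qed
  obtain n where n: "n > 0" "\<forall>x\<in>A \<union> range (to_ac :: 'f \<Rightarrow> _). x ^ (?p ^ n) = x"
    using frobenius_common_period[of "A \<union> range (to_ac :: 'f \<Rightarrow> _)" ?p] fin alg by auto
  let ?r = "?p ^ n"
  define K where "K = {x :: 'f alg_closure. x ^ ?r = x}"
  have r: "?r > 1" using p n(1) prime_gt_1_nat one_less_power by blast
  have add: "(x + y) ^ ?r = x ^ ?r + y ^ ?r" for x y :: "'f alg_closure"
    by (rule freshmans_dream') (use p in auto)
  have minus: "(- x) ^ ?r = - (x ^ ?r)" for x :: "'f alg_closure"
    using add[of x "- x"] \<open>?p > 0\<close> by (simp add: add_eq_0_iff power_0_left)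
  interpret R: field "ring_of_type_algebra :: 'f alg_closure ring" by (rule field_from_type_algebra)
  have uminus: "\<ominus>\<^bsub>ring_of_type_algebra\<^esub> x = - x" for x :: "'f alg_closure"
    by (rule R.minus_equality) (auto simp: ring_of_type_algebra_def)
  have inv: "inv\<^bsub>ring_of_type_algebra\<^esub> x = inverse x" if "x \<noteq> 0" for x :: "'f alg_closure"
    by (rule R.comm_inv_char) (use that in \<open>auto simp: ring_of_type_algebra_def\<close>)
  have "subfield K (ring_of_type_algebra :: 'f alg_closure ring)"
  proof (rule R.subfieldI')
    show "subring K (ring_of_type_algebra :: 'f alg_closure ring)"
    proof (rule R.subringI)
      show "\<ominus>\<^bsub>ring_of_type_algebra\<^esub> x \<in> K" if "x \<in> K" for x
        using that by (simp add: uminus K_def minus)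
    qed (auto simp: K_def ring_of_type_algebra_def add power_mult_distrib)
    show "inv\<^bsub>ring_of_type_algebra\<^esub> x \<in> K" if "x \<in> K - {\<zero>\<^bsub>ring_of_type_algebra\<^esub>}" for x
      using that inv[of x] by (auto simp: K_def ring_of_type_algebra_def power_inverse)
  qed
  moreover have "finite K"
  proof -
    define P :: "'f alg_closure poly" where "P = monom 1 ?r - monom 1 1"
    have "coeff P ?r = 1" using r by (simp add: P_def)
    then have "P \<noteq> 0" by auto
    moreover have "K = {x. poly P x = 0}" by (auto simp: K_def P_def poly_monom)
    ultimately show ?thesis by (simp add: poly_roots_finite)
  qed
  ultimately have "finite_extension K \<and> A \<subseteq> K"
    using n(2) by (auto simp: finite_extension_def K_def)
  then show ?thesis by blast
qed

subsection \<open>Rank of families of linear functionals\<close>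

text \<open>A pair \<open>d\<close> encodes the affine function \<open>b \<mapsto> fst d + (\<Sum>k\<in>J. b k * snd d k)\<close>.\<close>

lemma generic_point:
  fixes D :: "('a::field \<times> ('i \<Rightarrow> 'a)) set"
  assumes "infinite (UNIV :: 'a set)" and "finite J" and "finite D"
    and "\<And>d. d \<in> D \<Longrightarrow> fst d \<noteq> 0 \<or> (\<exists>k\<in>J. snd d k \<noteq> 0)"
  shows "\<exists>b. \<forall>d\<in>D. fst d + (\<Sum>k\<in>J. b k * snd d k) \<noteq> 0"
  using assms(2-)
proof (induction J arbitrary: D)
  case empty
  then show ?case by auto
next
  case (insert k J)
  \<comment> \<open>Functions that do not involve coordinate \<open>k\<close> are settled by the
    induction hypothesis. Each of the others excludes just one value \<open>?g d\<close> of that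
    coordinate once the rest of \<open>b\<close> is chosen.\<close>
  have "\<exists>b. \<forall>d\<in>{d\<in>D. snd d k = 0}. fst d + (\<Sum>j\<in>J. b j * snd d j) \<noteq> 0"
    using insert.prems by (intro insert.IH) auto
  then obtain b where b: "\<forall>d\<in>{d\<in>D. snd d k = 0}. fst d + (\<Sum>j\<in>J. b j * snd d j) \<noteq> 0"
    by blast
  let ?g = "\<lambda>d. - (fst d + (\<Sum>j\<in>J. b j * snd d j)) / snd d k"
  obtain t where t: "t \<notin> ?g ` D"
    using assms(1) insert.prems(1) by (meson ex_new_if_finite finite_imageI)
  have "fst d + (\<Sum>j\<in>insert k J. (b(k := t)) j * snd d j) \<noteq> 0" if d: "d \<in> D" for d
  proof (cases "snd d k = 0")
    case True
    have "(\<Sum>j\<in>J. (b(k := t)) j * snd d j) = (\<Sum>j\<in>J. b j * snd d j)"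
      using insert.hyps by (intro sum.cong) auto
    then show ?thesis using b d True insert.hyps by simp
  next
    case False
    have *: "(\<Sum>j\<in>J. (b(k := t)) j * snd d j) = (\<Sum>j\<in>J. b j * snd d j)"
      using insert.hyps by (intro sum.cong) auto
    have "t \<noteq> ?g d" using t d by blast
    with False have "t * snd d k \<noteq> - (fst d + (\<Sum>j\<in>J. b j * snd d j))" by (simp add: field_simps)
    then have "t * snd d k + (fst d + (\<Sum>j\<in>J. b j * snd d j)) \<noteq> 0"
      by (simp only: eq_neg_iff_add_eq_0 not_False_eq_True)
    then show ?thesis using * insert.hyps by (simp add: add.left_commute)
  qed
  then show ?case by blast
qed

section \<open>Linear functionals and subspaces in spaces of functions\<close>

definition linear_functional :: "(('j \<Rightarrow> 'a::field) \<Rightarrow> 'a) \<Rightarrow> bool" where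
  "linear_functional f \<longleftrightarrow>
     (\<forall>u v. f (\<lambda>j. u j + v j) = f u + f v) \<and> (\<forall>c u. f (\<lambda>j. c * u j) = c * f u)"

lemma linear_functional_add: "linear_functional f \<Longrightarrow> f (\<lambda>j. u j + v j) = f u + f v"
  and linear_functional_scale: "linear_functional f \<Longrightarrow> f (\<lambda>j. c * u j) = c * f u"
  by (simp_all add: linear_functional_def)

lemma linear_functional_add_scale:
  assumes "linear_functional f"
  shows "f (\<lambda>j. u j + c * v j) = f u + c * f v"
  using linear_functional_add[OF assms, of u "\<lambda>j. c * v j"] linear_functional_scale[OF assms, of c v]
  by simp

lemma linear_functional_sum:
  assumes "linear_functional f"
  shows "f (\<lambda>j. \<Sum>l\<in>A. a l * w l j) = (\<Sum>l\<in>A. a l * f (w l))"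
proof (induction A rule: infinite_finite_induct)
  case (insert x A)
  then show ?case
    using linear_functional_add[OF assms, of "\<lambda>j. a x * w x j" "\<lambda>j. \<Sum>l\<in>A. a l * w l j"]
    by (simp add: linear_functional_scale[OF assms])
qed (use linear_functional_scale[OF assms, of 0] in simp_all)

lemma linear_functional_combination:
  assumes "\<And>k. k \<in> J \<Longrightarrow> linear_functional (f k)"
  shows "linear_functional (\<lambda>z. \<Sum>k\<in>J. b k * f k z)"
  using assms
  by (simp add: linear_functional_def sum.distrib sum_distrib_left algebra_simps cong: sum.cong)

definition subspace_fun :: "('j \<Rightarrow> 'a::field) set \<Rightarrow> bool" where
  "subspace_fun U \<longleftrightarrow> (\<lambda>j. 0) \<in> U \<and> (\<forall>u\<in>U. \<forall>v\<in>U. (\<lambda>j. u j + v j) \<in> U) \<and>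
     (\<forall>c. \<forall>u\<in>U. (\<lambda>j. c * u j) \<in> U)"

lemma subspace_fun_add_scale:
  "subspace_fun U \<Longrightarrow> u \<in> U \<Longrightarrow> v \<in> U \<Longrightarrow> (\<lambda>j. u j + c * v j) \<in> U"
  by (simp add: subspace_fun_def)

lemma subspace_fun_sum:
  assumes "subspace_fun U" and "\<And>l. l \<in> A \<Longrightarrow> w l \<in> U"
  shows "(\<lambda>j. \<Sum>l\<in>A. a l * w l j) \<in> U"
  using assms(2)
proof (induction A rule: infinite_finite_induct)
  case (insert x A)
  then show ?case using assms(1) by (simp add: subspace_fun_def)
qed (use assms in \<open>auto simp: subspace_fun_def\<close>)

text \<open>The rank of the linear map with components \<open>f i\<close>, \<open>i \<in> I\<close>, on \<open>U\<close> is at least \<open>m\<close>.\<close>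

definition rank_ge ::
  "nat \<Rightarrow> ('j \<Rightarrow> 'a::field) set \<Rightarrow> ('i \<Rightarrow> ('j \<Rightarrow> 'a) \<Rightarrow> 'a) \<Rightarrow> 'i set \<Rightarrow> bool" where
  "rank_ge m U f I \<longleftrightarrow> (\<exists>w. (\<forall>l<m. w l \<in> U) \<and>
     (\<forall>a. (\<forall>i\<in>I. (\<Sum>l<m. a l * f i (w l)) = 0) \<longrightarrow> (\<forall>l<m. a l = 0)))"

lemma rank_ge_cong:
  assumes "rank_ge m U f I" and "\<And>i z. i \<in> I \<Longrightarrow> z \<in> U \<Longrightarrow> f i z = g i z"
  shows "rank_ge m U g I"
proof -
  obtain w where w: "\<And>l. l < m \<Longrightarrow> w l \<in> U"
    and indep: "\<And>a. (\<And>i. i \<in> I \<Longrightarrow> (\<Sum>l<m. a l * f i (w l)) = 0) \<Longrightarrow> \<forall>l<m. a l = 0"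
    using assms(1) unfolding rank_ge_def by blast
  have "(\<Sum>l<m. a l * f i (w l)) = (\<Sum>l<m. a l * g i (w l))" if "i \<in> I" for a i
    using assms(2) w that by (intro sum.cong) auto
  then show ?thesis using w indep unfolding rank_ge_def by (intro exI[of _ w]) simp
qed

text \<open>An identity submatrix certifies the rank: evaluating a vanishing combination at
  \<open>idx k\<close> isolates its \<open>k\<close>-th coefficient.\<close>

lemma rank_ge_of_inverse:
  assumes "\<And>l. l < m \<Longrightarrow> w l \<in> U" and "\<And>k. k < m \<Longrightarrow> idx k \<in> I"
    and "\<And>l k. l < m \<Longrightarrow> k < m \<Longrightarrow> f (idx k) (w l) = (if l = k then 1 else 0)"
  shows "rank_ge m U f I"
  unfolding rank_ge_def
proof (intro exI[of _ w] conjI allI impI)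
  fix a k assume "\<forall>i\<in>I. (\<Sum>l<m. a l * f i (w l)) = 0" and k: "k < m"
  then have "(\<Sum>l<m. a l * f (idx k) (w l)) = 0" using assms(2) by blast
  also have "(\<Sum>l<m. a l * f (idx k) (w l)) = (\<Sum>l<m. if l = k then a l else 0)"
    using assms(3) k by (intro sum.cong) auto
  finally show "a k = 0" using k by simp
qed (rule assms(1))

text \<open>
  With \<open>f\<close> read as a matrix \<open>A\<close> on \<open>U\<close>, \<open>b = A d\<close> as a further column and the rows \<open>g\<^sub>k\<close>, \<open>k \<in> J\<close>:
  if both \<open>[A | b]\<close> and \<open>A\<close> with the rows \<open>g\<^sub>k\<close> appended have rank at least \<open>m\<close>, then so has
  \<open>A + b (\<Sum>k. \<beta>\<^sub>k g\<^sub>k)\<close> for all \<open>\<beta>\<close> off an affine hyperplane.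
\<close>

lemma rank_ge_rank_one_update:
  fixes f :: "'i \<Rightarrow> ('j \<Rightarrow> 'a::field) \<Rightarrow> 'a" and d :: "'j \<Rightarrow> 'a"
  assumes lin: "\<And>i. i \<in> I \<union> J \<Longrightarrow> linear_functional (f i)"
    and U: "subspace_fun U"
    and src: "rank_ge m {u. \<exists>x\<in>U. \<exists>s. u = (\<lambda>j. x j + s * d j)} f I"
    and snk: "rank_ge m U f (I \<union> J)"
  shows "\<exists>c. (fst c \<noteq> 0 \<or> (\<exists>k\<in>J. snd c k \<noteq> 0)) \<and>
    (\<forall>b. fst c + (\<Sum>k\<in>J. b k * snd c k) \<noteq> 0 \<longrightarrow>
       rank_ge m U (\<lambda>i z. f i z + f i d * (\<Sum>k\<in>J. b k * f k z)) I)"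
proof (cases "rank_ge m U f I")
  case True
  then obtain w where w: "\<And>l. l < m \<Longrightarrow> w l \<in> U"
    and indep: "\<And>a. (\<And>i. i \<in> I \<Longrightarrow> (\<Sum>l<m. a l * f i (w l)) = 0) \<Longrightarrow> \<forall>l<m. a l = 0"
    unfolding rank_ge_def by blast
  \<comment> \<open>The rank is already \<open>m\<close> on vectors \<open>w\<close> of
    \<open>U\<close>. It can drop only if the image of \<open>d\<close> lies in the span of their
    images.\<close>
  show ?thesis
  proof (cases "\<exists>c. \<forall>i\<in>I. f i d = (\<Sum>l<m. c l * f i (w l))")
    case True
    then obtain c where c: "\<And>i. i \<in> I \<Longrightarrow> f i d = (\<Sum>l<m. c l * f i (w l))" by blast
    \<comment> \<open>On the span of the images of \<open>w\<close> the update acts as the identity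
      plus a rank-one matrix, whose determinant is \<open>1 + h cw\<close>. This is the affine
      function of \<open>b\<close> to be kept nonzero.\<close>
    define cw where "cw = (\<lambda>j. \<Sum>l<m. c l * w l j)"
    have "rank_ge m U (\<lambda>i z. f i z + f i d * (\<Sum>k\<in>J. b k * f k z)) I"
      if b: "1 + (\<Sum>k\<in>J. b k * f k cw) \<noteq> 0" for b
    proof -
      define h where "h z = (\<Sum>k\<in>J. b k * f k z)" for z
      have hcw: "h cw = (\<Sum>l<m. c l * h (w l))"
        unfolding cw_def h_def
        by (rule linear_functional_sum, rule linear_functional_combination) (use lin in auto)
      have "\<forall>l<m. a l = 0"
        if a: "\<forall>i\<in>I. (\<Sum>l<m. a l * (f i (w l) + f i d * h (w l))) = 0" for a
      proof -
        define t where "t = (\<Sum>l<m. a l * h (w l))"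
        have "(\<Sum>l<m. (a l + t * c l) * f i (w l)) = 0" if i: "i \<in> I" for i
        proof -
          have "(\<Sum>l<m. (a l + t * c l) * f i (w l))
              = (\<Sum>l<m. a l * f i (w l)) + t * (\<Sum>l<m. c l * f i (w l))"
            by (simp add: algebra_simps sum.distrib sum_distrib_left)
          also have "\<dots> = (\<Sum>l<m. a l * (f i (w l) + f i d * h (w l)))"
            by (simp add: c[OF i, symmetric] t_def algebra_simps sum.distrib sum_distrib_left)
          finally show ?thesis using a i by simp
        qed
        then have al: "\<forall>l<m. a l + t * c l = 0" by (rule indep)
        then have "a l = - (t * c l)" if "l < m" for l
          using that by (simp add: eq_neg_iff_add_eq_0)
        then have "(\<Sum>l<m. a l * h (w l)) = (\<Sum>l<m. - (t * c l) * h (w l))"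
          by (intro sum.cong) auto
        then have "t = (\<Sum>l<m. - (t * c l) * h (w l))" by (simp only: t_def)
        also have "\<dots> = - (t * h cw)"
          by (simp add: hcw sum_distrib_left sum_negf mult.assoc)
        finally have "t * (1 + h cw) = 0" by (simp add: algebra_simps eq_neg_iff_add_eq_0)
        then have "t = 0" using b by (simp add: h_def)
        then show ?thesis using al by simp
      qed
      then show ?thesis unfolding rank_ge_def h_def[symmetric] using w by blast
    qed
    then show ?thesis by (intro exI[of _ "(1, \<lambda>k. f k cw)"]) auto
  next
    case False
    \<comment> \<open>The image of \<open>d\<close> is independent of the images of
      \<open>w\<close>, so adding multiples of it preserves independence for every \<open>b\<close>;
      the constant function 1 serves as witness.\<close>
    have "rank_ge m U (\<lambda>i z. f i z + f i d * (\<Sum>k\<in>J. b k * f k z)) I" for b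
    proof -
      define h where "h z = (\<Sum>k\<in>J. b k * f k z)" for z
      have "\<forall>l<m. a l = 0"
        if a: "\<forall>i\<in>I. (\<Sum>l<m. a l * (f i (w l) + f i d * h (w l))) = 0" for a
      proof -
        define t where "t = (\<Sum>l<m. a l * h (w l))"
        have eq: "(\<Sum>l<m. a l * f i (w l)) + f i d * t = 0" if "i \<in> I" for i
          using a that by (simp add: t_def algebra_simps sum.distrib sum_distrib_left)
        have "t = 0"
        proof (rule ccontr)
          assume t: "t \<noteq> 0"
          have "f i d = (\<Sum>l<m. (- a l / t) * f i (w l))" if i: "i \<in> I" for i
          proof -
            have "f i d * t = - (\<Sum>l<m. a l * f i (w l))"
              using eq[OF i] by (simp add: eq_neg_iff_add_eq_0 add.commute)
            then have "f i d = - (\<Sum>l<m. a l * f i (w l)) / t" using t by (simp add: field_simps)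
            then show ?thesis by (simp add: sum_divide_distrib sum_negf)
          qed
          then have "\<exists>c. \<forall>i\<in>I. f i d = (\<Sum>l<m. c l * f i (w l))"
            by (intro exI[of _ "\<lambda>l. - a l / t"]) auto
          then show False using False by simp
        qed
        then show ?thesis using eq by (intro indep) auto
      qed
      then show ?thesis unfolding rank_ge_def h_def[symmetric] using w by blast
    qed
    then show ?thesis by (intro exI[of _ "(1, \<lambda>k. 0)"]) auto
  qed
next
  case rank_lt: False
  obtain w s where w: "\<And>l. l < m \<Longrightarrow> w l \<in> U"
    and indep: "\<And>a. (\<And>i. i \<in> I \<Longrightarrow> (\<Sum>l<m. a l * f i (\<lambda>j. w l j + s l * d j)) = 0)
      \<Longrightarrow> \<forall>l<m. a l = 0"
  proof -
    obtain u where u: "\<And>l. l < m \<Longrightarrow> \<exists>x\<in>U. \<exists>s. u l = (\<lambda>j. x j + s * d j)"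
      "\<And>a. (\<And>i. i \<in> I \<Longrightarrow> (\<Sum>l<m. a l * f i (u l)) = 0) \<Longrightarrow> \<forall>l<m. a l = 0"
      using src unfolding rank_ge_def by blast
    then obtain w s where ws: "\<And>l. l < m \<Longrightarrow> w l \<in> U \<and> u l = (\<lambda>j. w l j + s l * d j)" by metis
    have "(\<Sum>l<m. a l * f i (u l)) = (\<Sum>l<m. a l * f i (\<lambda>j. w l j + s l * d j))" for a i
      using ws by (intro sum.cong) auto
    then show thesis using ws u(2) by (intro that[of w s]) auto
  qed
  have fi: "f i (\<lambda>j. x j + t * d j) = f i x + t * f i d" if "i \<in> I" for i x t
    using lin[of i] that by (intro linear_functional_add_scale) auto
  \<comment> \<open>A vector \<open>x\<close> of \<open>U\<close> with the same image as
    \<open>d\<close> could replace \<open>d\<close> in every \<open>w l + s l * d\<close>, giving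
    rank \<open>m\<close> on \<open>U\<close> itself.\<close>
  have d_indep: "\<exists>i\<in>I. f i d \<noteq> f i x" if x: "x \<in> U" for x
  proof (rule ccontr)
    assume "\<not> ?thesis"
    then have dx: "\<And>i. i \<in> I \<Longrightarrow> f i d = f i x" by auto
    define w' where "w' l = (\<lambda>j. w l j + s l * x j)" for l
    have "f i (w' l) = f i (\<lambda>j. w l j + s l * d j)" if "i \<in> I" for i l
      using linear_functional_add_scale[OF lin[of i]] that dx by (simp add: w'_def)
    then have "\<forall>a. (\<forall>i\<in>I. (\<Sum>l<m. a l * f i (w' l)) = 0) \<longrightarrow> (\<forall>l<m. a l = 0)"
      using indep by simp
    moreover have "w' l \<in> U" if "l < m" for l
      using U x w[OF that] by (simp add: w'_def subspace_fun_def)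
    ultimately show False using rank_lt unfolding rank_ge_def by blast
  qed
  \<comment> \<open>The rows \<open>J\<close> raise the rank, so some vector of \<open>U\<close> is
    killed by all of \<open>I\<close> but not by all of \<open>J\<close>: a relation among the
    \<open>I\<close>-images that the \<open>J\<close>-rows break.\<close>
  obtain n k where n: "n \<in> U" "\<And>i. i \<in> I \<Longrightarrow> f i n = 0" and k: "k \<in> J" "f k n \<noteq> 0"
  proof -
    obtain u where u: "\<And>l. l < m \<Longrightarrow> u l \<in> U"
      "\<And>a. (\<And>i. i \<in> I \<union> J \<Longrightarrow> (\<Sum>l<m. a l * f i (u l)) = 0) \<Longrightarrow> \<forall>l<m. a l = 0"
      using snk unfolding rank_ge_def by blast
    obtain a where a: "\<forall>i\<in>I. (\<Sum>l<m. a l * f i (u l)) = 0" "\<not> (\<forall>l<m. a l = 0)"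
      using rank_lt u(1) unfolding rank_ge_def by blast
    have "\<exists>k\<in>I \<union> J. (\<Sum>l<m. a l * f k (u l)) \<noteq> 0" using u(2)[of a] a(2) by metis
    then obtain k where "k \<in> J" "(\<Sum>l<m. a l * f k (u l)) \<noteq> 0" using a(1) by blast
    moreover have "f i (\<lambda>j. \<Sum>l<m. a l * u l j) = (\<Sum>l<m. a l * f i (u l))" if "i \<in> I \<union> J" for i
      by (rule linear_functional_sum[OF lin[OF that]])
    moreover have "(\<lambda>j. \<Sum>l<m. a l * u l j) \<in> U"
      using U u(1) by (intro subspace_fun_sum) auto
    ultimately show thesis using a(1) by (intro that[of "\<lambda>j. \<Sum>l<m. a l * u l j" k]) auto
  qed
  obtain p where p: "p < m" "s p \<noteq> 0"
  proof (rule ccontr)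
    assume "\<not> thesis"
    then have "\<And>l. l < m \<Longrightarrow> s l = 0" using that by blast
    then have "(\<Sum>l<m. a l * f i (\<lambda>j. w l j + s l * d j)) = (\<Sum>l<m. a l * f i (w l))" for a i
      by (intro sum.cong) auto
    then have "\<forall>a. (\<forall>i\<in>I. (\<Sum>l<m. a l * f i (w l)) = 0) \<longrightarrow> (\<forall>l<m. a l = 0)"
      using indep by simp
    then show False using rank_lt w unfolding rank_ge_def by blast
  qed
  \<comment> \<open>Eliminating the coefficients of \<open>d\<close> with the pivot \<open>p\<close> leaves \<open>m - 1\<close> vectors of \<open>U\<close>
    with independent images; the null vector \<open>n\<close> takes the place of the pivot.\<close>
  define w' where "w' l = (if l = p then n else (\<lambda>j. w l j + (- s l / s p) * w p j))" for l
  have w'U: "w' l \<in> U" if "l < m" for l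
    using subspace_fun_add_scale[OF U w[OF that] w[OF p(1)], of "- s l / s p"] n(1)
    by (simp add: w'_def)
  have "rank_ge m U (\<lambda>i z. f i z + f i d * (\<Sum>k\<in>J. b k * f k z)) I"
    if b: "(\<Sum>k\<in>J. b k * f k n) \<noteq> 0" for b
  proof -
    define h where "h z = (\<Sum>k\<in>J. b k * f k z)" for z
    have "\<forall>l<m. a l = 0"
      if a: "\<forall>i\<in>I. (\<Sum>l<m. a l * (f i (w' l) + f i d * h (w' l))) = 0" for a
    proof -
      define t where "t = (\<Sum>l<m. a l * h (w' l))"
      define x where "x = (\<lambda>j. \<Sum>l<m. a l * w' l j)"
      have fx: "f i x = (\<Sum>l<m. a l * f i (w' l))" if "i \<in> I" for i
        unfolding x_def using lin that by (intro linear_functional_sum) auto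
      have xU: "x \<in> U" unfolding x_def using U w'U by (intro subspace_fun_sum) auto
      have eq: "f i x + f i d * t = 0" if "i \<in> I" for i
        using a that by (simp add: fx t_def algebra_simps sum.distrib sum_distrib_left)
      \<comment> \<open>Otherwise the image of \<open>d\<close> would be a multiple of the image of
        \<open>x\<close>, against \<open>d_indep\<close>.\<close>
      have t: "t = 0"
      proof (rule ccontr)
        assume t: "t \<noteq> 0"
        have "f i d = f i (\<lambda>j. (- 1 / t) * x j)" if i: "i \<in> I" for i
        proof -
          have "f i (\<lambda>j. (- 1 / t) * x j) = (- 1 / t) * f i x"
            using lin[of i] i by (intro linear_functional_scale) auto
          moreover have "f i x = - (f i d * t)" using eq[OF i] by (simp add: eq_neg_iff_add_eq_0)
          ultimately show ?thesis using t by simp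
        qed
        moreover have "(\<lambda>j. (- 1 / t) * x j) \<in> U" using U xU unfolding subspace_fun_def by blast
        ultimately show False using d_indep[of "\<lambda>j. (- 1 / t) * x j"] by auto
      qed
      \<comment> \<open>This undoes the elimination: the coefficient at \<open>p\<close> is chosen
        so that all multiples of \<open>d\<close> cancel, which turns the relation among the
        \<open>w' l\<close> into one among the \<open>w l + s l * d\<close>.\<close>
      define a' where "a' l = (if l = p then - (\<Sum>l\<in>{..<m} - {p}. a l * s l) / s p else a l)" for l
      have split: "sum g {..<m} = g p + sum g ({..<m} - {p})" for g :: "nat \<Rightarrow> 'a"
        using p(1) by (simp add: sum.remove)
      have "(\<Sum>l<m. a' l * f i (\<lambda>j. w l j + s l * d j)) = 0" if i: "i \<in> I" for i
      proof -
        let ?R = "{..<m} - {p}"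
        have fw': "f i (w' l) = f i (w l) - s l / s p * f i (w p)" if "l \<noteq> p" for l
          using that i linear_functional_add_scale[OF lin[of i], of "w l" "- s l / s p" "w p"]
          by (simp add: w'_def)
        have "(\<Sum>l<m. a' l * f i (\<lambda>j. w l j + s l * d j))
            = a' p * (f i (w p) + s p * f i d) + (\<Sum>l\<in>?R. a l * (f i (w l) + s l * f i d))"
          by (simp add: split fi[OF i]) (simp add: a'_def)
        also have "\<dots> = (\<Sum>l\<in>?R. a l * f i (w' l))"
        proof -
          have "(\<Sum>l\<in>?R. a l * f i (w' l)) = (\<Sum>l\<in>?R. a l * (f i (w l) - s l / s p * f i (w p)))"
            by (intro sum.cong) (auto simp: fw')
          then show ?thesis using p(2)
            by (simp add: a'_def algebra_simps sum.distrib sum_subtractf sum_distrib_left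
                sum_divide_distrib add_divide_distrib)
        qed
        also have "\<dots> = f i x" using n(2)[OF i] by (simp add: fx[OF i] split w'_def)
        also have "\<dots> = 0" using eq[OF i] t by simp
        finally show ?thesis .
      qed
      then have a'0: "\<forall>l<m. a' l = 0" by (rule indep)
      then have a0: "a l = 0" if "l < m" "l \<noteq> p" for l using that by (metis a'_def)
      then have "(\<Sum>l\<in>{..<m} - {p}. a l * h (w' l)) = 0" by (intro sum.neutral) auto
      then have "a p * h n = 0" using t by (simp add: t_def split w'_def)
      then have "a p = 0" using b by (simp add: h_def)
      then show ?thesis using a0 by blast
    qed
    then show ?thesis unfolding rank_ge_def h_def[symmetric] using w'U by blast
  qed
  \<comment> \<open>The witness is a linear form in \<open>b\<close> without constant term, nonzero
    because \<open>f k n\<close> is.\<close>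
  then show ?thesis using k by (intro exI[of _ "(0, \<lambda>k. f k n)"]) auto
qed

subsection \<open>Dual families and matrix rank\<close>

text \<open>Induction as in Gaussian elimination: the part of \<open>u r\<close> outside the span of
  its predecessors is nonzero at some \<open>i0\<close>, and this coordinate yields the new dual
  functional.\<close>

lemma dual_family:
  fixes u :: "nat \<Rightarrow> 'i \<Rightarrow> 'a::field"
  assumes fin: "finite I"
    and indep: "\<And>a. (\<And>i. i \<in> I \<Longrightarrow> (\<Sum>l<r. a l * u l i) = 0) \<Longrightarrow> \<forall>l<r. a l = 0"
  shows "\<exists>q. \<forall>l<r. \<forall>k<r. (\<Sum>i\<in>I. q l i * u k i) = (if l = k then 1 else 0)"
  using indep
proof (induction r)
  case 0
  then show ?case by simp
next
  case (Suc r)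
  have "\<forall>l<r. a l = 0" if a: "\<And>i. i \<in> I \<Longrightarrow> (\<Sum>l<r. a l * u l i) = 0" for a
  proof -
    have "\<forall>l<Suc r. (a(r := 0)) l = 0"
    proof (rule Suc.prems)
      fix i assume "i \<in> I"
      moreover have "(\<Sum>l<r. (a(r := 0)) l * u l i) = (\<Sum>l<r. a l * u l i)"
        by (intro sum.cong) auto
      ultimately show "(\<Sum>l<Suc r. (a(r := 0)) l * u l i) = 0" using a by simp
    qed
    then show ?thesis by (metis fun_upd_other less_Suc_eq less_irrefl)
  qed
  from Suc.IH[OF this] obtain q
    where q: "\<And>l k. l < r \<Longrightarrow> k < r \<Longrightarrow> (\<Sum>i\<in>I. q l i * u k i) = (if l = k then 1 else 0)"
    by blast
  \<comment> \<open>The old dual functionals read off the coefficients of a projection onto the span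
    of the first \<open>r\<close> vectors; \<open>v\<close> is what this projection leaves of
    \<open>u r\<close>.\<close>
  define c where "c l = (\<Sum>i\<in>I. q l i * u r i)" for l
  define v where "v i = u r i - (\<Sum>l<r. c l * u l i)" for i
  have "\<exists>i\<in>I. v i \<noteq> 0"
  proof (rule ccontr)
    assume "\<not> ?thesis"
    then have v0: "v i = 0" if "i \<in> I" for i using that by auto
    define a where "a l = (if l = r then 1 else - c l)" for l
    have "\<forall>l<Suc r. a l = 0"
    proof (rule Suc.prems)
      fix i assume "i \<in> I"
      have "(\<Sum>l<r. a l * u l i) = (\<Sum>l<r. - (c l * u l i))"
        by (intro sum.cong) (auto simp: a_def)
      then show "(\<Sum>l<Suc r. a l * u l i) = 0"
        using v0[OF \<open>i \<in> I\<close>] by (simp add: a_def v_def sum_negf)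
    qed
    then show False by (auto simp: a_def)
  qed
  then obtain i0 where i0: "i0 \<in> I" "v i0 \<noteq> 0" by blast
  \<comment> \<open>\<open>p\<close> takes the coordinate \<open>i0\<close> of a vector minus its
    projection, scaled to be 1 at \<open>u r\<close>; it vanishes at all earlier vectors.\<close>
  define p where "p i = ((if i = i0 then 1 else 0) - (\<Sum>l<r. u l i0 * q l i)) / v i0" for i
  have p_eq: "(\<Sum>i\<in>I. p i * w i) = (w i0 - (\<Sum>l<r. u l i0 * (\<Sum>i\<in>I. q l i * w i))) / v i0"
    for w :: "'i \<Rightarrow> 'a"
  proof -
    have "(\<Sum>i\<in>I. p i * w i)
        = (\<Sum>i\<in>I. (if i = i0 then w i else 0) - (\<Sum>l<r. u l i0 * (q l i * w i))) / v i0"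
      unfolding sum_divide_distrib
      by (intro sum.cong) (auto simp: p_def algebra_simps sum_distrib_left)
    also have "(\<Sum>i\<in>I. (if i = i0 then w i else 0) - (\<Sum>l<r. u l i0 * (q l i * w i)))
        = w i0 - (\<Sum>i\<in>I. \<Sum>l<r. u l i0 * (q l i * w i))"
      using fin i0(1) by (simp add: sum_subtractf)
    also have "(\<Sum>i\<in>I. \<Sum>l<r. u l i0 * (q l i * w i)) = (\<Sum>l<r. u l i0 * (\<Sum>i\<in>I. q l i * w i))"
      by (subst sum.swap) (simp add: sum_distrib_left)
    finally show ?thesis .
  qed
  have p_low: "(\<Sum>i\<in>I. p i * u k i) = 0" if "k < r" for k
  proof -
    have "(\<Sum>l<r. u l i0 * (\<Sum>i\<in>I. q l i * u k i)) = (\<Sum>l<r. if l = k then u l i0 else 0)"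
      using that by (intro sum.cong) (auto simp: q)
    then show ?thesis using that by (simp add: p_eq)
  qed
  have p_r: "(\<Sum>i\<in>I. p i * u r i) = 1"
    using i0(2) by (simp add: p_eq flip: c_def) (simp add: v_def mult.commute)
  \<comment> \<open>Subtracting \<open>c l * p\<close> makes the old functionals vanish at
    \<open>u r\<close> without changing their values at the earlier vectors.\<close>
  define q' where "q' l = (if l = r then p else (\<lambda>i. q l i - c l * p i))" for l
  have "(\<Sum>i\<in>I. q' l i * u k i) = (if l = k then 1 else 0)" if "l < Suc r" "k < Suc r" for l k
  proof (cases "l = r")
    case True
    then show ?thesis using that p_low p_r by (auto simp: q'_def less_Suc_eq)
  next
    case False
    then have "l < r" using that by simp
    have "(\<Sum>i\<in>I. q' l i * u k i) = (\<Sum>i\<in>I. q l i * u k i) - c l * (\<Sum>i\<in>I. p i * u k i)"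
      using False by (simp add: q'_def algebra_simps sum_subtractf sum_distrib_left)
    then show ?thesis
      using that False \<open>l < r\<close> q[of l k] p_low[of k] p_r by (cases "k = r") (auto simp: c_def)
  qed
  then show ?case by blast
qed

lemma square_inverse_swap:
  fixes B W :: "nat \<Rightarrow> nat \<Rightarrow> 'a::field"
  assumes "\<And>l k. l < m \<Longrightarrow> k < m \<Longrightarrow> (\<Sum>t<m. B l t * W t k) = (if l = k then 1 else 0)"
    and "s < m" "t < m"
  shows "(\<Sum>l<m. W s l * B l t) = (if s = t then 1 else 0)"
proof -
  let ?B = "mat m m (\<lambda>(i, j). B i j)" and ?W = "mat m m (\<lambda>(i, j). W i j)"
  have "?B * ?W = 1\<^sub>m m"
    using assms(1) by (intro eq_matI) (auto simp: scalar_prod_def lessThan_atLeast0)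
  then have "?W * ?B = 1\<^sub>m m"
    by (intro mat_mult_left_right_inverse[of ?B m ?W]) auto
  then have "(?W * ?B) $$ (s, t) = 1\<^sub>m m $$ (s, t)" by simp
  then show ?thesis using assms(2,3) by (simp add: scalar_prod_def lessThan_atLeast0)
qed

text \<open>A maximal independent set of columns gives a rank factorisation. Since equal columns may
  occur at several positions, \<open>idx\<close> selects one position for each basis vector.\<close>

lemma (in vec_space) rank_column_basis:
  assumes A: "A \<in> carrier_mat n nc"
  shows "\<exists>idx Q. (\<forall>l<rank A. idx l < nc) \<and>
    (\<forall>i<n. \<forall>j<nc. A $$ (i, j) = (\<Sum>l<rank A. A $$ (i, idx l) * Q l j)) \<and>
    (\<forall>a. (\<forall>i<n. (\<Sum>l<rank A. a l * A $$ (i, idx l)) = 0) \<longrightarrow> (\<forall>l<rank A. a l = 0))"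
proof -
  let ?P = "\<lambda>B. B \<subseteq> set (cols A) \<and> lin_indpt B"
  obtain B where B: "finite B" "maximal B ?P"
    using maximal_exists_superset[of "set (cols A)" ?P "{}"]
    by (auto simp: lin_dep_def)
  have sub: "B \<subseteq> set (cols A)" and ind: "lin_indpt B" using B(2) unfolding maximal_def by auto
  have cc: "set (cols A) \<subseteq> carrier_vec n" using cols_dim A by blast
  then have Bc: "B \<subseteq> carrier_vec n" using sub by blast
  have r: "rank A = card B" by (rule rank_card_indpt[OF A B(2)])
  obtain h where h: "bij_betw h {..<rank A} B"
    using ex_bij_betw_nat_finite[OF B(1)] r by (auto simp: lessThan_atLeast0)
  have "\<exists>j<nc. h l = col A j" if "l < rank A" for l
  proof -
    have "h l \<in> set (cols A)" using h that sub by (auto simp: bij_betw_def)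
    then show ?thesis using A by (auto simp: cols_def)
  qed
  then obtain idx where idx: "\<And>l. l < rank A \<Longrightarrow> idx l < nc \<and> h l = col A (idx l)" by metis
  have reindex: "(\<Sum>x\<in>B. g x) = (\<Sum>l<rank A. g (h l))" for g :: "'a vec \<Rightarrow> 'a"
    using sum.reindex_bij_betw[OF h, of g] by simp
  have span: "col A j \<in> span B" if j: "j < nc" for j
  proof (cases "col A j \<in> B")
    case True
    then show ?thesis using span_mem Bc by auto
  next
    case False
    have cA: "col A j \<in> set (cols A)" using j A by (auto simp: cols_def)
    have "lin_dep (B \<union> {col A j})"
    proof (rule ccontr)
      assume "\<not> ?thesis"
      then have "B \<union> {col A j} = B" using B(2) sub cA unfolding maximal_def by auto
      then show False using False by blast
    qed
    then show ?thesis using lin_dep_iff_in_span[OF _ ind _ False] Bc cA cc by auto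
  qed
  have "\<exists>a. col A j = lincomb a B" if "j < nc" for j
    using span[OF that] finite_span[OF B(1)] Bc by auto
  then obtain a where a: "\<And>j. j < nc \<Longrightarrow> col A j = lincomb (a j) B" by metis
  have 1: "\<forall>l<rank A. idx l < nc" using idx by blast
  have 2: "\<forall>i<n. \<forall>j<nc. A $$ (i, j) = (\<Sum>l<rank A. A $$ (i, idx l) * a j (h l))"
  proof (intro allI impI)
    show "A $$ (i, j) = (\<Sum>l<rank A. A $$ (i, idx l) * a j (h l))" if "i < n" "j < nc" for i j
    proof -
      have "A $$ (i, j) = lincomb (a j) B $ i" using that A a[of j] by (metis carrier_matD index_col)
      also have "\<dots> = (\<Sum>x\<in>B. a j x * x $ i)" using lincomb_index[OF that(1)] Bc by simp
      also have "\<dots> = (\<Sum>l<rank A. A $$ (i, idx l) * a j (h l))"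
        unfolding reindex using idx A that(1) by (intro sum.cong) (auto simp: mult.commute)
      finally show ?thesis .
    qed
  qed
  have 3: "\<forall>c. (\<forall>i<n. (\<Sum>l<rank A. c l * A $$ (i, idx l)) = 0) \<longrightarrow> (\<forall>l<rank A. c l = 0)"
  proof (intro allI impI)
    fix c k assume c: "\<forall>i<n. (\<Sum>l<rank A. c l * A $$ (i, idx l)) = 0" and k: "k < rank A"
    show "c k = 0"
    proof -
      \<comment> \<open>Library independence concerns coefficients attached to vectors; injectivity
        of \<open>h\<close> lets coefficients indexed by \<open>l\<close> be moved there.\<close>
      define c' where "c' x = c (inv_into {..<rank A} h x)" for x
      have c'h: "c' (h l) = c l" if "l < rank A" for l
        using h that by (simp add: c'_def bij_betw_def)
      have "lincomb c' B = 0\<^sub>v n"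
      proof (rule eq_vecI)
        fix i assume "i < dim_vec (0\<^sub>v n)"
        then have i: "i < n" by simp
        have "lincomb c' B $ i = (\<Sum>l<rank A. c l * A $$ (i, idx l))"
          unfolding lincomb_index[OF i Bc] reindex
          using c'h idx A i by (intro sum.cong) auto
        then show "lincomb c' B $ i = 0\<^sub>v n $ i" using c i by simp
      qed (use lincomb_dim[OF B(1) Bc] in simp)
      then have "c' \<in> B \<rightarrow> {0}" using not_lindepD[OF ind B(1) order_refl, of c'] by auto
      then have "c' (h k) = 0" using h k by (auto simp: bij_betw_def)
      then show ?thesis using c'h[OF k] by simp
    qed
  qed
  show ?thesis
    by (rule exI[of _ idx], rule exI[of _ "\<lambda>l j. a j (h l)"]) (intro conjI 1 2 3)
qed

text \<open>The dual family of a column basis, cut down to \<open>m\<close> members, gives rows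
  \<open>p\<close> that turn the selected columns into an identity matrix.\<close>

lemma (in vec_space) rank_right_inverse:
  assumes A: "A \<in> carrier_mat n nc" and m: "m \<le> rank A"
  shows "\<exists>p idx. (\<forall>k<m. idx k < nc) \<and>
    (\<forall>l<m. \<forall>k<m. (\<Sum>i<n. p l i * A $$ (i, idx k)) = (if l = k then 1 else 0))"
proof -
  obtain idx where idx: "\<forall>l<rank A. idx l < nc"
    and indep: "\<forall>a. (\<forall>i<n. (\<Sum>l<rank A. a l * A $$ (i, idx l)) = 0) \<longrightarrow> (\<forall>l<rank A. a l = 0)"
    using rank_column_basis[OF A] by (elim exE conjE) (rule that)
  have "\<exists>p. \<forall>l<rank A. \<forall>k<rank A.
    (\<Sum>i\<in>{..<n}. p l i * A $$ (i, idx k)) = (if l = k then 1 else 0)"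
  proof (rule dual_family)
    fix a assume "\<And>i. i \<in> {..<n} \<Longrightarrow> (\<Sum>l<rank A. a l * A $$ (i, idx l)) = 0"
    then have "\<forall>i<n. (\<Sum>l<rank A. a l * A $$ (i, idx l)) = 0" by simp
    then show "\<forall>l<rank A. a l = 0" by (rule indep[THEN spec, THEN mp])
  qed simp
  then obtain p where "\<forall>l<rank A. \<forall>k<rank A.
    (\<Sum>i<n. p l i * A $$ (i, idx k)) = (if l = k then 1 else 0)" by blast
  then show ?thesis using idx m by (intro exI[of _ p] exI[of _ idx]) auto
qed

subsection \<open>Cut matrices\<close>

lemma le_mincut_iff:
  assumes "wf_network G" and "S \<in> nodes G" "T \<noteq> S"
  shows "k \<le> mincut TYPE('f::{field, finite}) G S T \<longleftrightarrow>
    (\<forall>\<Omega>. \<Omega> \<subseteq> nodes G \<and> S \<in> \<Omega> \<and> T \<notin> \<Omega> \<longrightarrow>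
      k \<le> vec_space.rank (card (row_ports G \<Omega>)) (cut_matrix G \<Omega> :: 'f mat))"
proof -
  let ?R = "{vec_space.rank (card (row_ports G \<Omega>)) (cut_matrix G \<Omega> :: 'f mat) |\<Omega>.
      \<Omega> \<subseteq> nodes G \<and> S \<in> \<Omega> \<and> T \<notin> \<Omega>}"
  have "finite (Pow (nodes G))" using assms(1) by (simp add: wf_network_def)
  then have "finite ?R"
    by (rule finite_surj[of _ _ "\<lambda>\<Omega>. vec_space.rank (card (row_ports G \<Omega>)) (cut_matrix G \<Omega> :: 'f mat)"])
      auto
  \<comment> \<open>\<open>{S}\<close> is an admissible cut because \<open>T \<noteq> S\<close>, so
    the minimum is taken over a nonempty set.\<close>
  moreover have "?R \<noteq> {}" using assms(2,3) by (auto intro!: exI[of _ "{S}"])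
  ultimately show ?thesis unfolding mincut_def by (auto simp: Min_ge_iff)
qed

lemma cut_matrix_carrier:
  "cut_matrix G \<Omega> \<in> carrier_mat (card (row_ports G \<Omega>)) (card (col_ports G \<Omega>))"
  by (simp add: cut_matrix_def)

lemma sum_from_nat_into:
  assumes "finite A"
  shows "(\<Sum>i<card A. g (from_nat_into A i)) = sum g A"
  using sum.reindex_bij_betw[OF bij_betw_from_nat_into_finite[OF assms]] by simp

subsection \<open>Coding one port at a time\<close>

definition unit_fun :: "'j \<Rightarrow> 'j \<Rightarrow> 'a::field" where
  "unit_fun p = (\<lambda>j. if j = p then 1 else 0)"

locale source_network =
  fixes G :: "('v, 'p) network" and S :: 'v and m :: nat
  assumes wf: "wf_network G" and acyc: "acyclic_network G"
begin

definition outs :: "'p set" where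
  "outs = (\<Union>V\<in>nodes G. out_ports G V)"

definition ins :: "'p set" where
  "ins = (\<Union>V\<in>nodes G. in_ports G V)"

text \<open>The coding order: \<open>e1\<close> feeds the node that sends \<open>e\<close>, so it
  has to be coded first.\<close>

definition port_deps :: "('p \<times> 'p) set" where
  "port_deps = {(e1, e). \<exists>V\<in>nodes G. e \<in> out_ports G V \<and> (\<exists>e'\<in>in_ports G V. (e1, e') \<in> edges G)}"

text \<open>
  Network states are vectors indexed by the source symbols (\<open>Inl\<close>) and the ports (\<open>Inr\<close>).
  A family \<open>v\<close> of functionals gives the symbol sent at each output port;
  \<open>received v j\<close> is then what a node sees at the input port \<open>j = Inr e'\<close>, while the source
  also sees its own symbols \<open>j = Inl i\<close>.
\<close>

definition inputs :: "'v \<Rightarrow> (nat + 'p) set" where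
  "inputs V = Inr ` in_ports G V \<union> (if V = S then Inl ` {1..m} else {})"

definition received ::
  "('p \<Rightarrow> (nat + 'p \<Rightarrow> 'a::field) \<Rightarrow> 'a) \<Rightarrow> nat + 'p \<Rightarrow> (nat + 'p \<Rightarrow> 'a) \<Rightarrow> 'a" where
  "received v j z = (case j of Inl i \<Rightarrow> z (Inl i) | Inr e' \<Rightarrow> \<Sum>e | (e, e') \<in> edges G. v e z)"

text \<open>Only port coordinates are restricted: the source symbols always belong to the source
  side of a cut.\<close>

definition supported_on :: "'p set \<Rightarrow> (nat + 'p \<Rightarrow> 'a::field) set" where
  "supported_on Q = {z. \<forall>e. e \<notin> Q \<longrightarrow> z (Inr e) = 0}"

text \<open>The sink side of the cut whose source side consists of the source symbols and the ports \<open>Q\<close>,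
  once the ports in \<open>P\<close> carry fixed functions of the source symbols.\<close>

definition sink_side :: "'p set \<Rightarrow> 'p set \<Rightarrow> 'v \<Rightarrow> 'v set" where
  "sink_side P Q T = {V \<in> nodes G. V = T \<or> \<not> out_ports G V \<subseteq> P \<union> Q}"

text \<open>Uncoded ports are free variables that read their own coordinate. Coded ports have all
  upstream coding substituted, so by the last clause they see only the source symbols.\<close>

definition coded ::
  "'p set \<Rightarrow> ('p \<Rightarrow> (nat + 'p \<Rightarrow> 'a::field) \<Rightarrow> 'a) \<Rightarrow> (nat + 'p \<Rightarrow> 'p \<Rightarrow> 'a) \<Rightarrow> bool" where
  "coded P v \<beta> \<longleftrightarrow>
     (\<forall>e. linear_functional (v e)) \<and>
     (\<forall>e. e \<notin> P \<longrightarrow> v e = (\<lambda>z. z (Inr e))) \<and>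
     (\<forall>e\<in>P. \<forall>V\<in>nodes G. e \<in> out_ports G V \<longrightarrow>
        (\<forall>z. v e z = (\<Sum>j\<in>inputs V. \<beta> j e * received v j z))) \<and>
     (\<forall>e\<in>P. \<forall>z z'. (\<forall>i\<in>{1..m}. z (Inl i) = z' (Inl i)) \<longrightarrow> v e z = v e z')"

text \<open>The induction invariant. \<open>Q\<close> need not contain all outputs of a node,
  because the induction moves single ports across the cut.\<close>

definition cuts_ge ::
  "'v set \<Rightarrow> 'p set \<Rightarrow> ('p \<Rightarrow> (nat + 'p \<Rightarrow> 'a::field) \<Rightarrow> 'a) \<Rightarrow> bool" where
  "cuts_ge D P v \<longleftrightarrow> (\<forall>T\<in>D. \<forall>Q\<subseteq>outs - P.
     rank_ge m (supported_on Q) (received v) (\<Union>V\<in>sink_side P Q T. inputs V))"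

lemma finite_outs: "finite outs"
  using wf by (auto simp: outs_def wf_network_def)

lemma finite_inputs: "V \<in> nodes G \<Longrightarrow> finite (inputs V)"
  using wf unfolding inputs_def wf_network_def by simp

lemma out_ports_unique:
  "V \<in> nodes G \<Longrightarrow> W \<in> nodes G \<Longrightarrow> e \<in> out_ports G V \<Longrightarrow> e \<in> out_ports G W \<Longrightarrow> V = W"
  using wf unfolding wf_network_def by blast

lemma in_out_disjoint:
  "V \<in> nodes G \<Longrightarrow> e \<in> in_ports G V \<Longrightarrow> e \<notin> outs"
  using wf unfolding wf_network_def outs_def by blast

lemma edge_ports:
  assumes "(e, e') \<in> edges G"
  obtains V W where "V \<in> nodes G" "W \<in> nodes G" "e \<in> out_ports G V" "e' \<in> in_ports G W"
  using wf assms unfolding wf_network_def by fast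

text \<open>Among the nodes that send on a port of \<open>P\<close>, acyclicity provides one with no
  arc to another; any of its ports in \<open>P\<close> will do.\<close>

lemma port_deps_maximal:
  assumes "P \<subseteq> outs" "P \<noteq> {}"
  obtains e0 where "e0 \<in> P" "\<And>e. e \<in> P \<Longrightarrow> (e0, e) \<notin> port_deps"
proof -
  have "wf ((arcs G)\<inverse>)"
    using wf acyc finite_acyclic_wf_converse finite_arcs unfolding acyclic_network_def by blast
  moreover obtain e where "e \<in> P" using assms(2) by blast
  moreover from this obtain V where "V \<in> nodes G" "e \<in> out_ports G V"
    using assms(1) unfolding outs_def by blast
  ultimately obtain V where V: "V \<in> {V \<in> nodes G. out_ports G V \<inter> P \<noteq> {}}"
    "\<And>W. (W, V) \<in> (arcs G)\<inverse> \<Longrightarrow> W \<notin> {V \<in> nodes G. out_ports G V \<inter> P \<noteq> {}}"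
    using wfE_min[of "(arcs G)\<inverse>" V "{V \<in> nodes G. out_ports G V \<inter> P \<noteq> {}}"] by blast
  then obtain e0 where e0: "e0 \<in> out_ports G V" "e0 \<in> P" by blast
  have "(e0, e) \<notin> port_deps" if "e \<in> P" for e
  proof
    assume "(e0, e) \<in> port_deps"
    then obtain W e' where W: "W \<in> nodes G" "e \<in> out_ports G W" "e' \<in> in_ports G W"
      "(e0, e') \<in> edges G"
      unfolding port_deps_def by blast
    then have "(W, V) \<in> (arcs G)\<inverse>" using V(1) e0(1) unfolding arcs_def by blast
    then show False using V(2) W \<open>e \<in> P\<close> by blast
  qed
  then show thesis using that e0(2) by blast
qed

lemma subspace_supported_on: "subspace_fun (supported_on Q)"
  by (auto simp: subspace_fun_def supported_on_def)

lemma linear_functional_received: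
  assumes "\<And>e. linear_functional (v e)"
  shows "linear_functional (received v j)"
proof (cases j)
  case (Inl i)
  then show ?thesis by (simp add: linear_functional_def received_def)
next
  case (Inr e')
  then show ?thesis
    using linear_functional_combination[of "{e. (e, e') \<in> edges G}" v "\<lambda>_. 1"] assms
    by (simp add: received_def[abs_def])
qed

text \<open>This brings a port moved to the source side into the shape of the column extension in
  \<open>rank_ge_rank_one_update\<close>.\<close>

lemma supported_on_insert:
  "supported_on (insert e Q) =
    {u. \<exists>x\<in>supported_on Q. \<exists>s. u = (\<lambda>j. x j + s * unit_fun (Inr e) j)}" (is "_ = ?R")
proof (intro equalityI subsetI)
  fix u :: "nat + 'p \<Rightarrow> 'a" assume u: "u \<in> supported_on (insert e Q)"
  show "u \<in> ?R"
  proof (intro CollectI bexI[of _ "u(Inr e := 0)"] exI[of _ "u (Inr e)"])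
    show "u = (\<lambda>j. (u(Inr e := 0)) j + u (Inr e) * unit_fun (Inr e) j)"
      by (auto simp: unit_fun_def)
    show "u(Inr e := 0) \<in> supported_on Q" using u by (auto simp: supported_on_def)
  qed
next
  fix u :: "nat + 'p \<Rightarrow> 'a" assume "u \<in> ?R"
  then show "u \<in> supported_on (insert e Q)" by (auto simp: supported_on_def unit_fun_def)
qed

text \<open>Induction on a set of ports closed under predecessors. A port with no successor in the
  set is coded last, so removing it keeps the set closed.\<close>

lemma exists_coding:
  fixes D :: "'v set"
  assumes inf: "infinite (UNIV :: 'a::field set)" and D: "finite D"
    and base: "cuts_ge D {} (\<lambda>e z :: nat + 'p \<Rightarrow> 'a. z (Inr e))"
    and P: "finite P" "P \<subseteq> outs" "\<And>e1 e. (e1, e) \<in> port_deps \<Longrightarrow> e \<in> P \<Longrightarrow> e1 \<in> P"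
  shows "\<exists>(v :: 'p \<Rightarrow> (nat + 'p \<Rightarrow> 'a) \<Rightarrow> 'a) \<beta>. coded P v \<beta> \<and> cuts_ge D P v"
  using P
proof (induction "card P" arbitrary: P)
  case 0
  have "coded {} (\<lambda>e z :: nat + 'p \<Rightarrow> 'a. z (Inr e)) (\<lambda>_ _. 0)"
    by (simp add: coded_def linear_functional_def)
  then show ?case using 0 base by auto
next
  case (Suc n)
  have "P \<noteq> {}" using Suc.hyps(2) by auto
  then obtain e0 where e0: "e0 \<in> P" "\<And>e. e \<in> P \<Longrightarrow> (e0, e) \<notin> port_deps"
    using port_deps_maximal Suc.prems(2) by blast
  let ?P = "P - {e0}"
  have "\<exists>(v :: 'p \<Rightarrow> (nat + 'p \<Rightarrow> 'a) \<Rightarrow> 'a) \<beta>. coded ?P v \<beta> \<and> cuts_ge D ?P v"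
  proof (rule Suc.hyps(1))
    show "n = card ?P" using Suc.hyps(2) Suc.prems(1) e0(1) by simp
    show "e1 \<in> ?P" if "(e1, e) \<in> port_deps" "e \<in> ?P" for e1 e
      using that Suc.prems(3) e0(2) by blast
  qed (use Suc.prems in auto)
  then obtain v :: "'p \<Rightarrow> (nat + 'p \<Rightarrow> 'a) \<Rightarrow> 'a" and \<beta>
    where coded: "coded ?P v \<beta>" and cuts: "cuts_ge D ?P v" by blast
  have lin: "linear_functional (v e)" for e using coded unfolding coded_def by blast
  have free: "v e = (\<lambda>z. z (Inr e))" if "e \<notin> ?P" for e using coded that unfolding coded_def by blast
  have eqn: "v e z = (\<Sum>j\<in>inputs V. \<beta> j e * received v j z)"
    if "e \<in> ?P" "V \<in> nodes G" "e \<in> out_ports G V" for e V z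
    using coded that unfolding coded_def by blast
  have src_only: "v e z = v e z'" if "e \<in> ?P" "\<forall>i\<in>{1..m}. z (Inl i) = z' (Inl i)" for e z z'
    using coded that unfolding coded_def by blast
  obtain V0 where V0: "V0 \<in> nodes G" "e0 \<in> out_ports G V0"
    using e0(1) Suc.prems(2) unfolding outs_def by blast
  let ?J = "inputs V0"
  let ?d = "unit_fun (Inr e0) :: nat + 'p \<Rightarrow> 'a"
  have pred: "e1 \<in> ?P" if "V \<in> nodes G" "e \<in> out_ports G V" "e \<in> P" "e' \<in> in_ports G V"
    "(e1, e') \<in> edges G" for V e e' e1
  proof -
    have "(e1, e) \<in> port_deps" using that unfolding port_deps_def by blast
    then show ?thesis using Suc.prems(3) e0(2) \<open>e \<in> P\<close> by blast
  qed
  define good where "good T Q b \<longleftrightarrow>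
    rank_ge m (supported_on Q) (\<lambda>i z. received v i z +
      received v i ?d * (\<Sum>k\<in>?J. b k * received v k z)) (\<Union>V\<in>sink_side P Q T. inputs V)" for T Q b
  have "\<exists>c. (fst c \<noteq> 0 \<or> (\<exists>k\<in>?J. snd c k \<noteq> 0)) \<and>
    (\<forall>b. fst c + (\<Sum>k\<in>?J. b k * snd c k) \<noteq> 0 \<longrightarrow> good T Q b)"
    if T: "T \<in> D" and Q: "Q \<subseteq> outs - P" for T Q
    unfolding good_def
  proof (rule rank_ge_rank_one_update)
    show "subspace_fun (supported_on Q :: (nat + 'p \<Rightarrow> 'a) set)" by (rule subspace_supported_on)
    show "linear_functional (received v i)" for i by (rule linear_functional_received[OF lin])
    have "insert e0 Q \<subseteq> outs - ?P" using Q e0(1) Suc.prems(2) by auto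
    then have "rank_ge m (supported_on (insert e0 Q)) (received v)
      (\<Union>V\<in>sink_side ?P (insert e0 Q) T. inputs V)"
      using cuts T unfolding cuts_ge_def by blast
    moreover have "sink_side ?P (insert e0 Q) T = sink_side P Q T"
      using e0(1) by (auto simp: sink_side_def)
    ultimately show "rank_ge m {u. \<exists>x\<in>supported_on Q. \<exists>s. u = (\<lambda>j. x j + s * ?d j)} (received v)
      (\<Union>V\<in>sink_side P Q T. inputs V)"
      by (simp only: supported_on_insert)
    have "Q \<subseteq> outs - ?P" using Q by auto
    then have "rank_ge m (supported_on Q) (received v) (\<Union>V\<in>sink_side ?P Q T. inputs V)"
      using cuts T unfolding cuts_ge_def by blast
    \<comment> \<open>If \<open>e0\<close> is neither coded nor in \<open>Q\<close>, its node
      \<open>V0\<close> falls on the sink side, which appends the rows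
      \<open>inputs V0\<close>.\<close>
    moreover have "V \<in> sink_side ?P Q T \<longleftrightarrow> V \<in> insert V0 (sink_side P Q T)" for V
      using V0 Q e0(1) out_ports_unique[OF V0(1) _ V0(2), of V] unfolding sink_side_def by auto
    then have "(\<Union>V\<in>sink_side ?P Q T. inputs V) = (\<Union>V\<in>sink_side P Q T. inputs V) \<union> ?J" by auto
    ultimately show "rank_ge m (supported_on Q) (received v)
      ((\<Union>V\<in>sink_side P Q T. inputs V) \<union> ?J)" by simp
  qed
  then have "\<exists>c. T \<in> D \<longrightarrow> Q \<subseteq> outs - P \<longrightarrow> (fst c \<noteq> 0 \<or> (\<exists>k\<in>?J. snd c k \<noteq> 0)) \<and>
      (\<forall>b. fst c + (\<Sum>k\<in>?J. b k * snd c k) \<noteq> 0 \<longrightarrow> good T Q b)" for T Q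
    by blast
  then obtain c where "\<And>T Q. T \<in> D \<longrightarrow> Q \<subseteq> outs - P \<longrightarrow>
      (fst (c T Q) \<noteq> 0 \<or> (\<exists>k\<in>?J. snd (c T Q) k \<noteq> 0)) \<and>
      (\<forall>b. fst (c T Q) + (\<Sum>k\<in>?J. b k * snd (c T Q) k) \<noteq> 0 \<longrightarrow> good T Q b)"
    by metis
  then have c: "fst (c T Q) \<noteq> 0 \<or> (\<exists>k\<in>?J. snd (c T Q) k \<noteq> 0)"
    "fst (c T Q) + (\<Sum>k\<in>?J. b k * snd (c T Q) k) \<noteq> 0 \<Longrightarrow> good T Q b"
    if "T \<in> D" "Q \<subseteq> outs - P" for T Q b
    using that by blast+
  \<comment> \<open>One coefficient vector must work for all destinations and all cuts at once;
    there are only finitely many such pairs.\<close>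
  let ?C = "(\<lambda>(T, Q). c T Q) ` (D \<times> Pow (outs - P))"
  have "\<exists>b. \<forall>d\<in>?C. fst d + (\<Sum>k\<in>?J. b k * snd d k) \<noteq> 0"
  proof (rule generic_point[OF inf])
    show "finite ?C" using D finite_outs by simp
    fix d assume "d \<in> ?C"
    then obtain T Q where "d = c T Q" "T \<in> D" "Q \<subseteq> outs - P" by auto
    then show "fst d \<noteq> 0 \<or> (\<exists>k\<in>?J. snd d k \<noteq> 0)" using c(1)[of T Q] by simp
  qed (rule finite_inputs[OF V0(1)])
  then obtain b where b: "\<forall>d\<in>?C. fst d + (\<Sum>k\<in>?J. b k * snd d k) \<noteq> 0" by blast
  have good: "good T Q b" if "T \<in> D" "Q \<subseteq> outs - P" for T Q
  proof (rule c(2)[OF that])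
    have "c T Q \<in> ?C" using that by (intro image_eqI[of _ _ "(T, Q)"]) auto
    with b show "fst (c T Q) + (\<Sum>k\<in>?J. b k * snd (c T Q) k) \<noteq> 0" by (rule bspec)
  qed
  define h where "h z = (\<Sum>k\<in>?J. b k * received v k z)" for z
  define v' where "v' = v(e0 := h)"
  define \<beta>' where "\<beta>' j e = (if e = e0 then b j else \<beta> j e)" for j e
  have lin_h: "linear_functional h"
    unfolding h_def by (intro linear_functional_combination linear_functional_received lin)
  \<comment> \<open>All ports feeding \<open>V0\<close> are already coded, since the set is closed
    under predecessors; hence \<open>h\<close> depends on the source symbols alone.\<close>
  have received_src: "received v k z = received v k z'"
    if "k \<in> ?J" "\<forall>i\<in>{1..m}. z (Inl i) = z' (Inl i)" for k z z'
  proof (cases k)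
    case (Inl i)
    then show ?thesis using that by (auto simp: received_def inputs_def split: if_splits)
  next
    case (Inr e')
    then have "e' \<in> in_ports G V0" using that(1) by (auto simp: inputs_def split: if_splits)
    then have "v e z = v e z'" if "(e, e') \<in> edges G" for e
      using src_only pred[OF V0 e0(1)] that \<open>\<forall>i\<in>{1..m}. _ i\<close> by blast
    then show ?thesis using Inr by (auto simp: received_def intro: sum.cong)
  qed
  have received_same: "received v' j z = received v j z"
    if "V \<in> nodes G" "e \<in> out_ports G V" "e \<in> P" "j \<in> inputs V" for V e j z
  proof (cases j)
    case (Inl i)
    then show ?thesis by (simp add: received_def)
  next
    case (Inr e')
    then have "e' \<in> in_ports G V" using that(4) by (auto simp: inputs_def split: if_splits)
    then have "v' e1 z = v e1 z" if "(e1, e') \<in> edges G" for e1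
      using pred[OF \<open>V \<in> _\<close> \<open>e \<in> out_ports G V\<close> \<open>e \<in> P\<close> _ that] by (simp add: v'_def)
    then show ?thesis using Inr by (auto simp: received_def intro: sum.cong)
  qed
  have "coded P v' \<beta>'"
    unfolding coded_def
  proof (intro conjI allI ballI impI)
    show "linear_functional (v' e)" for e using lin lin_h by (simp add: v'_def)
    show "v' e = (\<lambda>z. z (Inr e))" if "e \<notin> P" for e
      using that e0(1) free[of e] by (auto simp: v'_def)
    show "v' e z = (\<Sum>j\<in>inputs V. \<beta>' j e * received v' j z)"
      if "e \<in> P" "V \<in> nodes G" "e \<in> out_ports G V" for e V z
    proof -
      have "(\<Sum>j\<in>inputs V. \<beta>' j e * received v' j z) = (\<Sum>j\<in>inputs V. \<beta>' j e * received v j z)"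
        using received_same[OF that(2,3,1)] by (intro sum.cong) auto
      also have "\<dots> = v' e z"
      proof (cases "e = e0")
        case True
        then have "V = V0" using that V0 out_ports_unique by blast
        then show ?thesis using True by (simp add: v'_def \<beta>'_def h_def)
      next
        case False
        then show ?thesis using that eqn[of e V z] by (simp add: v'_def \<beta>'_def)
      qed
      finally show ?thesis by simp
    qed
    show "v' e z = v' e z'" if "e \<in> P" "\<forall>i\<in>{1..m}. z (Inl i) = z' (Inl i)" for e z z'
    proof (cases "e = e0")
      case True
      then show ?thesis using received_src[OF _ that(2)] by (simp add: v'_def h_def)
    next
      case False
      then show ?thesis using src_only[of e z z'] that by (simp add: v'_def)
    qed
  qed
  moreover have "cuts_ge D P v'"
    unfolding cuts_ge_def
  proof (intro ballI allI impI)
    fix T Q assume T: "T \<in> D" and Q: "Q \<subseteq> outs - P"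
    have "rank_ge m (supported_on Q) (\<lambda>i z. received v i z + received v i ?d * h z)
      (\<Union>V\<in>sink_side P Q T. inputs V)"
      using good[OF T Q] unfolding h_def good_def .
    then show "rank_ge m (supported_on Q) (received v') (\<Union>V\<in>sink_side P Q T. inputs V)"
    proof (rule rank_ge_cong)
      fix i and z :: "nat + 'p \<Rightarrow> 'a" assume z: "z \<in> supported_on Q"
      \<comment> \<open>As \<open>e0\<close> is outside \<open>Q\<close>, \<open>v e0\<close>
        vanishes at \<open>z\<close>. The unit vector at \<open>e0\<close> is seen by
        \<open>v e0\<close> alone, so adding \<open>h z\<close> times its image replaces exactly the
        symbol of \<open>e0\<close> by \<open>h z\<close>.\<close>
      have z0: "z (Inr e0) = 0" using z Q e0(1) by (auto simp: supported_on_def)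
      have "v e z + v e ?d * h z = v' e z" for e
      proof -
        consider "e = e0" | "e \<in> ?P" | "e \<notin> P" by blast
        then show ?thesis
        proof cases
          case 1
          then show ?thesis using free[of e0] z0 by (simp add: v'_def unit_fun_def)
        next
          case 2
          then have "v e ?d = v e (\<lambda>_. 0)" by (intro src_only) (auto simp: unit_fun_def)
          also have "\<dots> = 0" using linear_functional_scale[OF lin, of e 0] by simp
          finally show ?thesis using 2 by (simp add: v'_def)
        next
          case 3
          then show ?thesis using free[of e] e0(1) by (auto simp: v'_def unit_fun_def)
        qed
      qed
      then have "(\<Sum>e\<in>E. v e z) + (\<Sum>e\<in>E. v e ?d) * h z = (\<Sum>e\<in>E. v' e z)" for E
        by (simp add: sum_distrib_right flip: sum.distrib)
      then show "received v i z + received v i ?d * h z = received v' i z"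
        by (cases i) (simp_all add: received_def unit_fun_def)
    qed
  qed
  ultimately show ?case by blast
qed

section \<open>From min-cut bounds to the invariant before any coding\<close>

lemma row_ports_subset: "\<Omega> \<subseteq> nodes G \<Longrightarrow> row_ports G \<Omega> \<subseteq> outs"
  unfolding row_ports_def outs_def by blast

lemma finite_row_ports: "\<Omega> \<subseteq> nodes G \<Longrightarrow> finite (row_ports G \<Omega>)"
  using row_ports_subset finite_outs finite_subset by blast

lemma finite_col_ports: "finite (col_ports G \<Omega>)"
  using wf by (auto simp: col_ports_def wf_network_def)

text \<open>The nodes other than \<open>T\<close> whose outputs all lie in \<open>Q\<close> form an
  ordinary cut if they include \<open>S\<close>, and the min-cut bound then supplies the
  rank.\<close>

lemma cuts_ge_uncoded:
  assumes S: "S \<in> nodes G" and D: "\<And>T. T \<in> D \<Longrightarrow> T \<in> nodes G \<and> T \<noteq> S"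
    and cut: "\<And>T. T \<in> D \<Longrightarrow> m \<le> mincut TYPE('f::{field, finite}) G S T"
  shows "cuts_ge D {} (\<lambda>e z :: nat + 'p \<Rightarrow> 'f alg_closure. z (Inr e))"
  unfolding cuts_ge_def
proof (intro ballI allI impI)
  fix T Q assume T: "T \<in> D" and Q: "Q \<subseteq> outs - {}"
  let ?v = "\<lambda>e z :: nat + 'p \<Rightarrow> 'f alg_closure. z (Inr e)"
  let ?I = "\<Union>V\<in>sink_side {} Q T. inputs V"
  show "rank_ge m (supported_on Q) (received ?v) ?I"
  proof (cases "S \<in> sink_side {} Q T")
    case True
    \<comment> \<open>With \<open>S\<close> on the sink side its own symbols are among the inputs
      and already give rank \<open>m\<close>. They are numbered from 1, vectors from 0, hence the
      \<open>Suc\<close>.\<close>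
    show ?thesis
    proof (rule rank_ge_of_inverse[where w = "\<lambda>l. unit_fun (Inl (Suc l))" and idx = "\<lambda>k. Inl (Suc k)"])
      show "Inl (Suc k) \<in> ?I" if "k < m" for k
        using that True by (intro UN_I[of S]) (auto simp: inputs_def)
    qed (auto simp: supported_on_def received_def unit_fun_def)
  next
    case False
    define \<Omega> where "\<Omega> = nodes G - sink_side {} Q T"
    let ?R = "row_ports G \<Omega>" and ?A = "cut_matrix G \<Omega> :: 'f mat"
    have \<Omega>: "\<Omega> \<subseteq> nodes G" "S \<in> \<Omega>" "T \<notin> \<Omega>"
      using S False D[OF T] by (auto simp: \<Omega>_def sink_side_def)
    have RQ: "?R \<subseteq> Q" by (auto simp: row_ports_def \<Omega>_def sink_side_def)
    have finR: "finite ?R" by (rule finite_row_ports[OF \<Omega>(1)])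
    have sink: "nodes G - \<Omega> = sink_side {} Q T" by (auto simp: \<Omega>_def sink_side_def)
    have "m \<le> vec_space.rank (card ?R) ?A"
      using cut[OF T] le_mincut_iff[OF wf S, of T m] D[OF T] \<Omega> by blast
    then have "\<exists>p idx. (\<forall>k<m. idx k < card (col_ports G \<Omega>)) \<and> (\<forall>l<m. \<forall>k<m.
        (\<Sum>i<card ?R. p l i * ?A $$ (i, idx k)) = (if l = k then 1 else 0))"
      by (rule vec_space.rank_right_inverse[OF cut_matrix_carrier])
    then obtain p idx where idx': "\<forall>k<m. idx k < card (col_ports G \<Omega>)"
      and p': "\<forall>l<m. \<forall>k<m. (\<Sum>i<card ?R. p l i * ?A $$ (i, idx k)) = (if l = k then 1 else 0)"
      by (elim exE conjE) (rule that)
    have idx: "idx k < card (col_ports G \<Omega>)" if "k < m" for k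
      using idx' that by simp
    have p: "(\<Sum>i<card ?R. p l i * ?A $$ (i, idx k)) = (if l = k then 1 else 0)"
      if "l < m" "k < m" for l k
      using p' that by blast
    define c where "c k = from_nat_into (col_ports G \<Omega>) (idx k)" for k
    \<comment> \<open>The rank certificate \<open>p\<close> over the base field is carried into the
      closure by the homomorphism \<open>to_ac\<close>; the state \<open>w l\<close> puts its
      \<open>l\<close>-th row on the ports leaving \<Omega>.\<close>
    define w where "w l j = (case j of Inl i \<Rightarrow> 0 |
      Inr e \<Rightarrow> if e \<in> ?R then to_ac (p l (to_nat_on ?R e)) else 0)" for l and j :: "nat + 'p"
    show ?thesis
    proof (rule rank_ge_of_inverse[where w = w and idx = "\<lambda>k. Inr (c k)"])
      show "w l \<in> supported_on Q" for l using RQ by (auto simp: supported_on_def w_def)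
      show "Inr (c k) \<in> ?I" if k: "k < m" for k
      proof -
        have "c k \<in> col_ports G \<Omega>" unfolding c_def using idx[OF k]
          by (intro from_nat_into) auto
        then show ?thesis unfolding col_ports_def sink by (auto simp: inputs_def)
      qed
      fix l k assume lk: "l < m" "k < m"
      have A: "?A $$ (i, idx k) = (if (from_nat_into ?R i, c k) \<in> edges G then 1 else 0)"
        if "i < card ?R" for i
        using that idx[OF lk(2)] by (simp add: cut_matrix_def c_def)
      have "received ?v (Inr (c k)) (w l) = (\<Sum>e | (e, c k) \<in> edges G. w l (Inr e))"
        by (simp add: received_def)
      also have "\<dots> = (\<Sum>e\<in>?R. if (e, c k) \<in> edges G then w l (Inr e) else 0)"
      proof -
        have fin: "finite {e. (e, c k) \<in> edges G}"
          by (rule finite_subset[OF _ finite_outs]) (auto simp: outs_def elim: edge_ports)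
        have "(\<Sum>e\<in>?R. if (e, c k) \<in> edges G then w l (Inr e) else 0)
            = (\<Sum>e\<in>?R \<inter> {e. (e, c k) \<in> edges G}. w l (Inr e))"
          using finR by (simp add: sum.inter_restrict)
        also have "\<dots> = (\<Sum>e | (e, c k) \<in> edges G. w l (Inr e))"
          by (rule sum.mono_neutral_left[OF fin]) (auto simp: w_def)
        finally show ?thesis by simp
      qed
      also have "\<dots> = (\<Sum>i<card ?R. if (from_nat_into ?R i, c k) \<in> edges G
          then w l (Inr (from_nat_into ?R i)) else 0)"
        by (rule sum_from_nat_into[OF finR, symmetric])
      also have "\<dots> = (\<Sum>i<card ?R. to_ac (p l i * ?A $$ (i, idx k)))"
      proof (intro sum.cong refl)
        fix i assume "i \<in> {..<card ?R}"
        then have i: "i < card ?R" by simp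
        then have "from_nat_into ?R i \<in> ?R" by (intro from_nat_into) auto
        moreover have "to_nat_on ?R (from_nat_into ?R i) = i"
          using i to_nat_on_from_nat_into to_nat_on_finite[OF finR] by (metis bij_betw_imp_surj_on lessThan_iff)
        ultimately show "(if (from_nat_into ?R i, c k) \<in> edges G
          then w l (Inr (from_nat_into ?R i)) else 0) = to_ac (p l i * ?A $$ (i, idx k))"
          by (simp add: A[OF i] w_def)
      qed
      also have "\<dots> = (if l = k then 1 else 0)"
        unfolding to_ac_sum[symmetric] p[OF lk] by simp
      finally show "received ?v (Inr (c k)) (w l) = (if l = k then 1 else 0)" .
    qed
  qed
qed

subsection \<open>Decoding\<close>

text \<open>With all ports coded the invariant for \<open>Q = {}\<close> has sink side
  \<open>{T}\<close>, so the transfer matrix from the source symbols to the inputs of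
  \<open>T\<close> has a left inverse.\<close>

lemma decoding_coefficients:
  fixes v :: "'p \<Rightarrow> (nat + 'p \<Rightarrow> 'a::field) \<Rightarrow> 'a"
  assumes coded: "coded outs v \<beta>" and cuts: "cuts_ge D outs v"
    and T: "T \<in> D" "T \<in> nodes G" "T \<noteq> S"
  shows "\<exists>\<epsilon>. \<forall>k\<in>{1..m}. \<forall>z. (\<Sum>e'\<in>in_ports G T. \<epsilon> e' k * received v (Inr e') z) = z (Inl k)"
proof -
  let ?I = "in_ports G T"
  let ?r = "\<lambda>e'. received v (Inr e')"
  have finI: "finite ?I" using wf T(2) by (simp add: wf_network_def)
  have lin: "linear_functional (?r e')" for e'
    using coded by (intro linear_functional_received) (simp add: coded_def)
  have src_only: "v e z = v e z'" if "e \<in> outs" "\<forall>i\<in>{1..m}. z (Inl i) = z' (Inl i)" for e z z'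
    using coded that unfolding coded_def by blast
  have "sink_side outs {} T = {T}" using T(2) by (auto simp: sink_side_def outs_def)
  then have "rank_ge m (supported_on {}) (received v) (inputs T)"
    using cuts T(1) unfolding cuts_ge_def by fastforce
  then obtain w where
    indep: "\<And>a. (\<And>i. i \<in> inputs T \<Longrightarrow> (\<Sum>l<m. a l * received v i (w l)) = 0) \<Longrightarrow> \<forall>l<m. a l = 0"
    unfolding rank_ge_def by blast
  have "\<exists>q. \<forall>l<m. \<forall>k<m. (\<Sum>e'\<in>?I. q l e' * ?r e' (w k)) = (if l = k then 1 else 0)"
    by (rule dual_family[OF finI]) (use indep T(3) in \<open>auto simp: inputs_def\<close>)
  then obtain q where q: "\<And>l k. l < m \<Longrightarrow> k < m \<Longrightarrow>
      (\<Sum>e'\<in>?I. q l e' * ?r e' (w k)) = (if l = k then 1 else 0)" by blast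
  let ?u = "\<lambda>t. unit_fun (Inl (Suc t)) :: nat + 'p \<Rightarrow> 'a"
  \<comment> \<open>Coded ports ignore port coordinates, so a received symbol is determined by its
    values at the source unit vectors.\<close>
  have expand: "?r e' z = (\<Sum>t<m. z (Inl (Suc t)) * ?r e' (?u t))" for e' z
  proof -
    let ?z = "\<lambda>j. \<Sum>t<m. z (Inl (Suc t)) * ?u t j"
    have "z (Inl i) = ?z (Inl i)" if "i \<in> {1..m}" for i
    proof -
      have "?z (Inl i) = (\<Sum>t<m. if t = i - 1 then z (Inl i) else 0)"
        using that by (intro sum.cong) (auto simp: unit_fun_def)
      then show ?thesis using that by auto
    qed
    then have *: "\<forall>i\<in>{1..m}. z (Inl i) = ?z (Inl i)" by blast
    have "v e z = v e ?z" if "(e, e') \<in> edges G" for e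
      by (rule src_only[OF _ *]) (use that in \<open>auto simp: outs_def elim: edge_ports\<close>)
    then have "?r e' z = ?r e' ?z" by (simp add: received_def)
    then show ?thesis using linear_functional_sum[OF lin] by simp
  qed
  define B where "B l t = (\<Sum>e'\<in>?I. q l e' * ?r e' (?u t))" for l t
  have qz: "(\<Sum>e'\<in>?I. q l e' * ?r e' z) = (\<Sum>t<m. B l t * z (Inl (Suc t)))" for l z
    unfolding B_def sum_distrib_right by (subst sum.swap) (simp add: expand[of _ z] sum_distrib_left algebra_simps)
  \<comment> \<open>\<open>q\<close> inverts the images of the \<open>w l\<close>, so
    \<open>B\<close> times the matrix of source coordinates of \<open>w\<close> is the identity.
    Swapping these square factors makes \<open>w\<close> combined with \<open>q\<close> a
    decoder.\<close>
  have WB: "(\<Sum>l<m. w l (Inl (Suc s)) * B l t) = (if s = t then 1 else 0)" if "s < m" "t < m" for s t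
    by (rule square_inverse_swap[where W = "\<lambda>s l. w l (Inl (Suc s))"]) (use that q qz in auto)
  define \<epsilon> where "\<epsilon> e' k = (\<Sum>l<m. w l (Inl k) * q l e')" for e' k
  have "(\<Sum>e'\<in>?I. \<epsilon> e' k * ?r e' z) = z (Inl k)" if k: "k \<in> {1..m}" for k z
  proof -
    obtain s where s: "k = Suc s" "s < m" using k by (cases k) auto
    have "(\<Sum>e'\<in>?I. \<epsilon> e' k * ?r e' z) = (\<Sum>l<m. w l (Inl k) * (\<Sum>e'\<in>?I. q l e' * ?r e' z))"
      unfolding \<epsilon>_def sum_distrib_right sum_distrib_left by (subst sum.swap) (simp add: mult.assoc)
    also have "\<dots> = (\<Sum>l<m. \<Sum>t<m. w l (Inl k) * B l t * z (Inl (Suc t)))"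
      by (simp add: qz sum_distrib_left mult.assoc)
    also have "\<dots> = (\<Sum>t<m. (\<Sum>l<m. w l (Inl k) * B l t) * z (Inl (Suc t)))"
      by (subst sum.swap) (simp add: sum_distrib_right)
    also have "\<dots> = (\<Sum>t<m. if s = t then z (Inl (Suc t)) else 0)"
      using WB s by (intro sum.cong) auto
    finally show ?thesis using s by simp
  qed
  then show ?thesis by blast
qed

text \<open>The symbols computed from \<open>v\<close> satisfy the transmission equations, which
  have only one solution in an acyclic network.\<close>

lemma port_symbols_of_coded:
  fixes v :: "'p \<Rightarrow> (nat + 'p \<Rightarrow> 'a::field) \<Rightarrow> 'a"
  assumes coded: "coded outs v \<beta>"
    and src: "\<And>i e. i \<in> {1..m} \<Longrightarrow> e \<in> outs \<Longrightarrow> src c i e = \<beta> (Inl i) e"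
    and fwd: "\<And>e' e. e' \<in> ins \<Longrightarrow> e \<in> outs \<Longrightarrow> fwd c e' e = \<beta> (Inr e') e"
    and Y: "port_symbols K G S m c x Y" and V: "V \<in> nodes G" "e' \<in> in_ports G V"
  shows "Y e' = received v (Inr e') (case_sum x (\<lambda>_. 0))"
proof -
  define z :: "nat + 'p \<Rightarrow> 'a" where "z = case_sum x (\<lambda>_. 0)"
  define Y' where "Y' p = (if p \<in> outs then v p z else received v (Inr p) z)" for p
  have Y'_in: "Y' p = received v (Inr p) z" if "V \<in> nodes G" "p \<in> in_ports G V" for V p
    using in_out_disjoint[OF that] by (simp add: Y'_def)
  \<comment> \<open>Uniqueness is applied over the whole field, where the membership condition on
    the symbols of \<open>Y'\<close> is trivial.\<close>
  have "port_symbols UNIV G S m c x Y'"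
    unfolding port_symbols_def
  proof (intro conjI ballI)
    fix V e assume V: "V \<in> nodes G" and e: "e \<in> out_ports G V"
    then have eo: "e \<in> outs" by (auto simp: outs_def)
    have fwd_eq: "fwd c e' e = \<beta> (Inr e') e" if "e' \<in> in_ports G V" for e'
      by (rule fwd[OF _ eo]) (use V that in \<open>auto simp: ins_def\<close>)
    have "Y' e = (\<Sum>j\<in>inputs V. \<beta> j e * received v j z)"
      using coded V e eo by (simp add: Y'_def coded_def)
    also have "\<dots> = (\<Sum>j\<in>Inr ` in_ports G V. \<beta> j e * received v j z)
        + (\<Sum>j\<in>(if V = S then Inl ` {1..m} else {}). \<beta> j e * received v j z)"
      unfolding inputs_def using wf V by (intro sum.union_disjoint) (auto simp: wf_network_def)
    also have "(\<Sum>j\<in>Inr ` in_ports G V. \<beta> j e * received v j z)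
        = (\<Sum>e'\<in>in_ports G V. fwd c e' e * Y' e')"
      by (auto simp: sum.reindex Y'_in[OF V] fwd_eq intro!: sum.cong)
    also have "(\<Sum>j\<in>(if V = S then Inl ` {1..m} else {}). \<beta> j e * received v j z)
        = (if V = S then \<Sum>i=1..m. src c i e * x i else 0)"
      using eo src by (auto simp: sum.reindex received_def z_def intro!: sum.cong)
    finally show "Y' e = (\<Sum>e'\<in>in_ports G V. fwd c e' e * Y' e')
      + (if V = S then \<Sum>i=1..m. src c i e * x i else 0)" .
  next
    fix V e' assume V: "V \<in> nodes G" and e': "e' \<in> in_ports G V"
    have "e \<in> outs" if "(e, e') \<in> edges G" for e
      using that by (auto simp: outs_def elim: edge_ports)
    then show "Y' e' = (\<Sum>e | (e, e') \<in> edges G. Y' e)"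
      by (simp add: Y'_in[OF V e'] received_def) (simp add: Y'_def)
  qed simp
  moreover have "port_symbols UNIV G S m c x Y" using Y by (simp add: port_symbols_def)
  ultimately have "Y e' = Y' e'"
    using port_symbols_unique[OF wf acyc] V by blast
  then show ?thesis using Y'_in[OF V] by (simp add: z_def)
qed

lemma solvable_if_mincut:
  assumes S: "S \<in> nodes G" and D: "finite D" "\<And>T. T \<in> D \<Longrightarrow> T \<in> nodes G \<and> T \<noteq> S"
    and cut: "\<And>T. T \<in> D \<Longrightarrow> m \<le> mincut TYPE('f::{field, finite}) G S T"
  shows "solvable TYPE('f) G S m ((\<lambda>T. (S, T, {1..m})) ` D)"
proof -
  have "cuts_ge D {} (\<lambda>e z :: nat + 'p \<Rightarrow> 'f alg_closure. z (Inr e))"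
    using cuts_ge_uncoded[OF S D(2) cut] .
  then have "\<exists>(v :: 'p \<Rightarrow> (nat + 'p \<Rightarrow> 'f alg_closure) \<Rightarrow> 'f alg_closure) \<beta>.
      coded outs v \<beta> \<and> cuts_ge D outs v"
    by (rule exists_coding[OF infinite_UNIV_alg_closed D(1) _ finite_outs order_refl])
      (auto simp: port_deps_def outs_def elim: edge_ports)
  then obtain v :: "'p \<Rightarrow> (nat + 'p \<Rightarrow> 'f alg_closure) \<Rightarrow> 'f alg_closure" and \<beta>
    where coded: "coded outs v \<beta>" and cuts: "cuts_ge D outs v" by blast
  have "\<exists>\<epsilon>. \<forall>k\<in>{1..m}. \<forall>z. (\<Sum>e'\<in>in_ports G T. \<epsilon> e' k * received v (Inr e') z) = z (Inl k)"
    if "T \<in> D" for T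
    using decoding_coefficients[OF coded cuts that] D(2)[OF that] by blast
  then obtain \<epsilon> where \<epsilon>: "\<And>T k z. T \<in> D \<Longrightarrow> k \<in> {1..m} \<Longrightarrow>
      (\<Sum>e'\<in>in_ports G T. \<epsilon> T e' k * received v (Inr e') z) = z (Inl k)"
    by metis
  \<comment> \<open>Coefficients outside the finite index ranges are set to 0, so only finitely many
    values occur and one finite extension holds them all.\<close>
  define c :: "('v, 'p, 'f alg_closure) scheme" where "c = \<lparr>
      src = (\<lambda>i e. if i \<in> {1..m} \<and> e \<in> outs then \<beta> (Inl i) e else 0),
      fwd = (\<lambda>e' e. if e' \<in> ins \<and> e \<in> outs then \<beta> (Inr e') e else 0),
      dst = (\<lambda>e' (T, k). if e' \<in> ins \<and> T \<in> D \<and> k \<in> {1..m} then \<epsilon> T e' k else 0),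
      nu = (\<lambda>_. m) \<rparr>"
  have finI: "finite ins" using wf by (auto simp: ins_def wf_network_def)
  let ?A = "{0} \<union> (\<lambda>(i, e). \<beta> (Inl i) e) ` ({1..m} \<times> outs)
    \<union> (\<lambda>(e', e). \<beta> (Inr e') e) ` (ins \<times> outs) \<union> (\<lambda>(e', T, k). \<epsilon> T e' k) ` (ins \<times> D \<times> {1..m})"
  have "finite ?A" using finI finite_outs D(1) by blast
  from finite_extension_containing[OF this]
  obtain K :: "'f alg_closure set" where K: "finite_extension K" "?A \<subseteq> K"
    by (elim exE conjE) (rule that)
  have "scheme_over K c"
    unfolding scheme_over_def c_def using K(2) by (auto simp: image_subset_iff)
  moreover have "established K G S m c (S, T, {1..m})" if T: "T \<in> D" for T
  proof -
    have "dest_symbol G c Y T k = x k"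
      if k: "k \<in> {1..m}" and Y: "port_symbols K G S m c x Y" for k x Y
    proof -
      have TG: "T \<in> nodes G" using D(2) T by blast
      have "Y e' = received v (Inr e') (case_sum x (\<lambda>_. 0))" if "e' \<in> in_ports G T" for e'
        by (rule port_symbols_of_coded[OF coded _ _ Y TG that]) (auto simp: c_def)
      then have "dest_symbol G c Y T k
          = (\<Sum>e'\<in>in_ports G T. \<epsilon> T e' k * received v (Inr e') (case_sum x (\<lambda>_. 0)))"
        unfolding dest_symbol_def using T TG k by (intro sum.cong) (auto simp: c_def ins_def)
      then show ?thesis using \<epsilon>[OF T k] by simp
    qed
    moreover have "nu c T = m" by (simp add: c_def)
    ultimately show ?thesis by auto
  qed
  ultimately show ?thesis using K(1) unfolding solvable_def by blast
qed

subsection \<open>Necessity of the cut condition\<close>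

lemma le_rank_of_established:
  fixes K :: "'f::{field, finite} alg_closure set"
  assumes K: "finite_extension K" and c: "scheme_over K c"
    and est: "established K G S m c (S, T, {1..m})"
    and T: "T \<in> nodes G"
    and \<Omega>: "\<Omega> \<subseteq> nodes G" "S \<in> \<Omega>" "T \<notin> \<Omega>"
  shows "m \<le> vec_space.rank (card (row_ports G \<Omega>)) (cut_matrix G \<Omega> :: 'f mat)"
proof -
  let ?R = "row_ports G \<Omega>" and ?C = "col_ports G \<Omega>" and ?A = "cut_matrix G \<Omega> :: 'f mat"
  let ?r = "vec_space.rank (card ?R) ?A"
  have sub: "subfield K (ring_of_type_algebra :: 'f alg_closure ring)" and fin: "finite K"
    and base: "range to_ac \<subseteq> K"
    using K by (auto simp: finite_extension_def)
  obtain idx Q where idx: "\<forall>l<?r. idx l < card ?C"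
    and Q: "\<forall>i<card ?R. \<forall>j<card ?C. ?A $$ (i, j) = (\<Sum>l<?r. ?A $$ (i, idx l) * Q l j)"
    using vec_space.rank_column_basis[OF cut_matrix_carrier[of G \<Omega>]] by (elim exE conjE) (rule that)
  have finR: "finite ?R" by (rule finite_row_ports[OF \<Omega>(1)])
  let ?X = "{1..m} \<rightarrow>\<^sub>E K"
  have "\<exists>Y. port_symbols K G S m c x Y" if "x \<in> ?X" for x
    using port_symbols_exist[OF wf acyc sub c] that by blast
  then obtain Y where Y: "\<And>x. x \<in> ?X \<Longrightarrow> port_symbols K G S m c (x :: nat \<Rightarrow> 'f alg_closure) (Y x)"
    by metis
  \<comment> \<open>The part of the symbol at \<open>e'\<close> that comes from inside \<Omega>;
    \<open>\<phi>\<close> records it at the basis columns only.\<close>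
  define cross where "cross x e' = (\<Sum>e | e \<in> ?R \<and> (e, e') \<in> edges G. Y x e)" for x e'
  define \<phi> where "\<phi> x = (\<lambda>l\<in>{..<?r}. cross x (from_nat_into ?C (idx l)))" for x
  have YK: "Y x e \<in> K" if "x \<in> ?X" "e \<in> outs" for x e
    using Y[OF that(1)] that(2) by (auto simp: port_symbols_def outs_def)
  have "\<phi> ` ?X \<subseteq> {..<?r} \<rightarrow>\<^sub>E K"
  proof -
    have "cross x e' \<in> K" if "x \<in> ?X" for x e'
      unfolding cross_def
      using YK[OF that] row_ports_subset[OF \<Omega>(1)] by (intro subfield_type_closed(4)[OF sub]) auto
    then show ?thesis unfolding \<phi>_def by (intro image_subsetI) (simp add: restrict_PiE_iff)
  qed
  moreover have "inj_on \<phi> ?X"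
  proof (rule inj_onI)
    fix x x' assume x: "x \<in> ?X" "x' \<in> ?X" and eq: "\<phi> x = \<phi> x'"
    have cross_sum: "cross z (from_nat_into ?C j)
        = (\<Sum>i<card ?R. Y z (from_nat_into ?R i) * to_ac (?A $$ (i, j)))" if j: "j < card ?C" for z j
    proof -
      have "cross z (from_nat_into ?C j)
          = (\<Sum>e\<in>?R. Y z e * (if (e, from_nat_into ?C j) \<in> edges G then 1 else 0))"
        unfolding cross_def using finR by (simp add: sum.inter_filter if_distrib cong: if_cong)
      also have "\<dots> = (\<Sum>i<card ?R. Y z (from_nat_into ?R i) *
          (if (from_nat_into ?R i, from_nat_into ?C j) \<in> edges G then 1 else 0))"
        by (rule sum_from_nat_into[OF finR, symmetric])
      also have "\<dots> = (\<Sum>i<card ?R. Y z (from_nat_into ?R i) * to_ac (?A $$ (i, j)))"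
        using j by (intro sum.cong) (auto simp: cut_matrix_def)
      finally show ?thesis .
    qed
    \<comment> \<open>By the factorisation of the cut matrix, the flow into every column is
      determined by the flow into the \<open>?r\<close> basis columns.\<close>
    have cross_basis: "cross z (from_nat_into ?C j)
        = (\<Sum>l<?r. cross z (from_nat_into ?C (idx l)) * to_ac (Q l j))" if j: "j < card ?C" for z j
    proof -
      have "cross z (from_nat_into ?C j)
          = (\<Sum>i<card ?R. Y z (from_nat_into ?R i) * (\<Sum>l<?r. to_ac (?A $$ (i, idx l)) * to_ac (Q l j)))"
        unfolding cross_sum[OF j]
      proof (intro sum.cong refl)
        fix i assume "i \<in> {..<card ?R}"
        then have "?A $$ (i, j) = (\<Sum>l<?r. ?A $$ (i, idx l) * Q l j)" using Q j by blast
        then show "Y z (from_nat_into ?R i) * to_ac (?A $$ (i, j)) =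
          Y z (from_nat_into ?R i) * (\<Sum>l<?r. to_ac (?A $$ (i, idx l)) * to_ac (Q l j))"
          by (simp only: to_ac_sum to_ac_mult)
      qed
      also have "\<dots> = (\<Sum>l<?r. (\<Sum>i<card ?R. Y z (from_nat_into ?R i) * to_ac (?A $$ (i, idx l))) * to_ac (Q l j))"
        unfolding sum_distrib_left sum_distrib_right by (subst sum.swap) (simp add: mult.assoc)
      also have "\<dots> = (\<Sum>l<?r. cross z (from_nat_into ?C (idx l)) * to_ac (Q l j))"
        using cross_sum idx by (intro sum.cong) auto
      finally show ?thesis .
    qed
    have cross_idx: "cross x (from_nat_into ?C (idx l)) = cross x' (from_nat_into ?C (idx l))"
      if "l < ?r" for l
      using fun_cong[OF eq, of l] that by (simp add: \<phi>_def)
    have cross_eq: "cross x e' = cross x' e'" if "e' \<in> ?C" for e'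
    proof -
      have "e' \<in> from_nat_into ?C ` {..<card ?C}"
        using that bij_betw_from_nat_into_finite[OF finite_col_ports, of \<Omega>] by (simp add: bij_betw_def)
      then obtain j where "j < card ?C" "e' = from_nat_into ?C j" by auto
      then show ?thesis using cross_basis[of j] cross_idx by simp
    qed
    note eqs = Y[OF x(1), unfolded port_symbols_def] Y[OF x(2), unfolded port_symbols_def]
    have "wf (arcs G)"
      using wf acyc finite_acyclic_wf finite_arcs unfolding acyclic_network_def by blast
    \<comment> \<open>Going forward along arcs, a node outside \<Omega> receives from \<Omega> only
      what \<open>cross\<close> records, and from elsewhere only symbols already shown
      equal.\<close>
    then have sink_eq: "V \<in> nodes G - \<Omega> \<longrightarrow> (\<forall>e\<in>in_ports G V \<union> out_ports G V. Y x e = Y x' e)" for V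
    proof (induction V rule: wf_induct_rule)
      case (less V)
      show ?case
      proof
        assume V: "V \<in> nodes G - \<Omega>"
        have inp: "Y x e' = Y x' e'" if e': "e' \<in> in_ports G V" for e'
        proof -
          have split: "(\<Sum>e | (e, e') \<in> edges G. Y z e)
              = cross z e' + (\<Sum>e | e \<notin> ?R \<and> (e, e') \<in> edges G. Y z e)" for z
          proof -
            let ?E = "{e. (e, e') \<in> edges G}"
            have fin: "finite ?E"
              by (rule finite_subset[OF _ finite_outs]) (auto simp: outs_def elim: edge_ports)
            have "{e. e \<in> ?R \<and> (e, e') \<in> edges G} = ?E \<inter> ?R"
              and "{e. e \<notin> ?R \<and> (e, e') \<in> edges G} = ?E - ?R" by auto
            then show ?thesis using sum.Int_Diff[OF fin, of "Y z" ?R] by (simp add: cross_def)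
          qed
          have "Y x e = Y x' e" if e: "e \<notin> ?R" "(e, e') \<in> edges G" for e
          proof -
            obtain W where W: "W \<in> nodes G" "e \<in> out_ports G W"
              by (rule edge_ports[OF e(2)])
            then have "W \<notin> \<Omega>" using e(1) unfolding row_ports_def by blast
            moreover have "(W, V) \<in> arcs G" using W V e' e(2) unfolding arcs_def by blast
            ultimately show ?thesis using less W by blast
          qed
          then have "(\<Sum>e | e \<notin> ?R \<and> (e, e') \<in> edges G. Y x e)
              = (\<Sum>e | e \<notin> ?R \<and> (e, e') \<in> edges G. Y x' e)"
            by (intro sum.cong) auto
          moreover have "e' \<in> ?C" using V e' unfolding col_ports_def by blast
          moreover have "Y x e' = (\<Sum>e | (e, e') \<in> edges G. Y x e)"
            and "Y x' e' = (\<Sum>e | (e, e') \<in> edges G. Y x' e)"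
            using eqs V e' by auto
          ultimately show ?thesis using split[of x] split[of x'] cross_eq[of e'] by simp
        qed
        moreover have "Y x e = Y x' e" if e: "e \<in> out_ports G V" for e
        proof -
          have "V \<noteq> S" using V \<Omega>(2) by blast
          then have "Y x e = (\<Sum>e'\<in>in_ports G V. fwd c e' e * Y x e')"
            and "Y x' e = (\<Sum>e'\<in>in_ports G V. fwd c e' e * Y x' e')"
            using eqs V e by auto
          moreover have "(\<Sum>e'\<in>in_ports G V. fwd c e' e * Y x e') = (\<Sum>e'\<in>in_ports G V. fwd c e' e * Y x' e')"
            using inp by (intro sum.cong) auto
          ultimately show ?thesis by simp
        qed
        ultimately show "\<forall>e\<in>in_ports G V \<union> out_ports G V. Y x e = Y x' e" by blast
      qed
    qed
    have same: "dest_symbol G c (Y x) T k = dest_symbol G c (Y x') T k" for k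
      unfolding dest_symbol_def using sink_eq[of T] T \<Omega>(3) by (intro sum.cong) auto
    \<comment> \<open>The decoder index \<open>k\<close> is the same for all source symbols, so
      equal symbols at \<open>T\<close> force equal \<open>x i\<close> and
      \<open>x' i\<close>.\<close>
    have "x i = x' i" if i: "i \<in> {1..m}" for i
    proof -
      have "\<exists>k. \<forall>x Y. (\<forall>j\<in>{1..m}. x j \<in> K) \<longrightarrow> port_symbols K G S m c x Y \<longrightarrow>
          dest_symbol G c Y T k = x i"
        using est i by (simp only: established.simps) blast
      then obtain k where k: "\<forall>x Y. (\<forall>j\<in>{1..m}. x j \<in> K) \<longrightarrow> port_symbols K G S m c x Y \<longrightarrow>
          dest_symbol G c Y T k = x i" ..
      have "dest_symbol G c (Y x) T k = x i" by (rule k[rule_format, OF _ Y[OF x(1)]]) (use x in auto)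
      moreover have "dest_symbol G c (Y x') T k = x' i" by (rule k[rule_format, OF _ Y[OF x(2)]]) (use x in auto)
      ultimately show ?thesis using same by simp
    qed
    then show "x = x'" using x by (intro PiE_ext[of x "{1..m}" "\<lambda>_. K" x']) auto
  qed
  ultimately have "card ?X \<le> card ({..<?r} \<rightarrow>\<^sub>E K)"
    using fin by (intro card_inj_on_le[of \<phi>]) (auto intro: finite_PiE)
  then have "card K ^ m \<le> card K ^ ?r" by (simp add: card_PiE)
  \<comment> \<open>Comparing exponents in the count requires a base above 1; \<open>K\<close>
    contains 0 and 1.\<close>
  moreover have "card K > 1"
  proof -
    have "{0, 1} \<subseteq> K" using base by (metis empty_subsetI insert_subset range_subsetD to_ac_0 to_ac_1)
    then have "card {0, 1 :: 'f alg_closure} \<le> card K" using fin card_mono by blast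
    then show ?thesis by simp
  qed
  ultimately show ?thesis using power_le_imp_le_exp by blast
qed

end

theorem theorem5:
  fixes G :: "('v, 'p) network" and S :: 'v and T :: "nat \<Rightarrow> 'v" and N m :: nat
    and C :: "'v connection set"
  assumes "wf_network G" and "acyclic_network G"
    and "S \<in> nodes G" and "m \<le> card (out_ports G S)"
    and "\<And>i. i \<in> {1..N} \<Longrightarrow> T i \<in> nodes G \<and> T i \<noteq> S"
    and "C = {(S, T i, {1..m}) | i. i \<in> {1..N}}"
  shows "solvable TYPE('f::{field, finite}) G S m C \<longleftrightarrow>
    (\<forall>i\<in>{1..N}. mincut TYPE('f) G S (T i) \<ge> m)"
proof -
  interpret source_network G S m using assms(1,2) by unfold_locales
  show ?thesis
  proof
    assume "solvable TYPE('f) G S m C"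
    then obtain K :: "'f alg_closure set" and c where K: "finite_extension K" "scheme_over K c"
      and est: "\<forall>con\<in>C. established K G S m c con"
      unfolding solvable_def by blast
    show "\<forall>i\<in>{1..N}. m \<le> mincut TYPE('f) G S (T i)"
    proof
      fix i assume i: "i \<in> {1..N}"
      then have "established K G S m c (S, T i, {1..m})" using est assms(6) by blast
      then show "m \<le> mincut TYPE('f) G S (T i)"
        using le_mincut_iff[OF assms(1,3)] le_rank_of_established[OF K] assms(5)[OF i] by blast
    qed
  next
    assume cut: "\<forall>i\<in>{1..N}. m \<le> mincut TYPE('f) G S (T i)"
    \<comment> \<open>Destinations enter as a set, so indices \<open>i\<close> with equal
      \<open>T i\<close> are merged.\<close>
    have "solvable TYPE('f) G S m ((\<lambda>T. (S, T, {1..m})) ` T ` {1..N})"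
    proof (rule solvable_if_mincut[OF assms(3)])
      fix V assume "V \<in> T ` {1..N}"
      then obtain i where "i \<in> {1..N}" "V = T i" by blast
      then show "V \<in> nodes G \<and> V \<noteq> S" and "m \<le> mincut TYPE('f) G S V"
        using assms(5)[of i] cut by simp_all
    qed simp
    moreover have "C = (\<lambda>T. (S, T, {1..m})) ` T ` {1..N}" using assms(6) by auto
    ultimately show "solvable TYPE('f) G S m C" by simp
  qed
qed

end
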